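(* Let $p\ge 5$ be a prime and $i\in\mathbb{N}_0$. Let $\gamma=c\,\vartheta_a$ (restricted to $\mathfrak{p}^i\wedge\mathfrak{p}^i$) for some unit $c\in\mathcal{U}$ of $\mathcal{O}$ and some integer $a$ with $2\le a\le (p-1)/2$, and write $\lambda=\lambda(\gamma)$. Then $\gamma\in\hat{H}_i$ and $|L_{i,\lambda}(\gamma)|=p^{2i+3+y}$ for some $y\in\{0,1,2\}$. If $p=5$, then $y=0$ holds.
   Context: Let $p$ be a prime, $\mathbb{Q}_p$ the field of $p$-adic numbers, $\mathbb{Z}_p$ the $p$-adic integers, $\theta$ a primitive $p$-th root of unity, and $K=\mathbb{Q}_p(\theta)$. Let $\mathcal{O}$ be the maximal order (ring of integers) of $K$ and $\mathfrak{p}$ its unique maximal ideal, generated by $\kappa=\theta-1$. $\mathcal{U}=\mathcal{O}\setminus\mathfrak{p}$ is the unit group of $\mathcal{O}$. For $n \in \mathbb{N}_0$, $\mathfrak{p}^n=\kappa^n\mathcal{O}$; put $\mathfrak{p}^\infty=\{0\}$. For $j\in\mathbb{Z}$ coprime to $p$ let $\sigma_j$ be the Galois automorphism of $K$ over $\mathbb{Q}_p$ with $\sigma_j(\theta)=\theta^j$. For $a\in\{2,\ldots,(p-1)/2\}$ define $\vartheta_a:K\wedge K\to K$ by $\vartheta_a(x\wedge y)=\sigma_a(x)\sigma_{1-a}(y)-\sigma_{1-a}(x)\sigma_a(y)$. For $i\in\mathbb{N}_0$, $\mathfrak{p}^i\wedge\mathfrak{p}^i$ is the exterior square over $\mathbb{Z}_p$,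 on which $\theta$ acts diagonally. $H_i=\mathrm{Hom}_\theta(\mathfrak{p}^i\wedge\mathfrak{p}^i,\mathfrak{p}^{2i+1})$ is the set of $\mathbb{Z}_p$-linear maps $\gamma:\mathfrak{p}^i\wedge\mathfrak{p}^i\to\mathfrak{p}^{2i+1}$ with $\gamma(\theta x\wedge\theta y)=\theta\,\gamma(x\wedge y)$, and $\hat{H}_i=\{\gamma\in H_i\mid\gamma\text{ surjective}\}$. For $\gamma\in\hat{H}_i$ and $u,v,w\in\mathfrak{p}^i$ let $J_\gamma(u,v,w)=\gamma(\gamma(u\wedge v)\wedge w)+\gamma(\gamma(v\wedge w)\wedge u)+\gamma(\gamma(w\wedge u)\wedge v)$. Let $J(\gamma)$ be the ideal of $\mathcal{O}$ generated by all $J_\gamma(u,v,w)$ with $u,v,w\in\mathfrak{p}^i$, and let $\lambda(\gamma)\in\mathbb{N}_0\cup\{\infty\}$ be defined by $J(\gamma)=\mathfrak{p}^{\lambda(\gamma)}$. $L_{i,m}(\gamma)$ denotes the set $\mathfrak{p}^i/\mathfrak{p}^m$ with its natural addition and the multiplication $[x+\mathfrak{p}^m,y+\mathfrak{p}^m]=\gamma(x\wedge y)+\mathfrak{p}^m$; $|L_{i,m}(\gamma)|$ is the cardinality of this set. *)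

theory Defs
  imports
    "HOL-Algebra.Algebraic_Closure_Type"
    "HOL-Library.Poly_Mapping"
    "HOL-Library.Extended_Nat"
    "HOL-Library.FuncSet"
    "Berlekamp_Zassenhaus.Finite_Field"
begin

section \<open>The $p$-adic integers and the $p$-adic numbers\<close>

text \<open>
  The prime $p$ is the cardinality of the index type \<open>'p\<close>.
  The ring of $p$-adic integers is the inverse limit of the rings $\mathbb{Z}/p^n$; the residue
  class modulo $p^n$ is represented by its least nonnegative member.
\<close>

typedef (overloaded) 'p :: prime_card padic_int =
  "{f :: nat \<Rightarrow> int. \<forall>n. 0 \<le> f n \<and> f n < int CARD('p) ^ n \<and>
      f (Suc n) mod int CARD('p) ^ n = f n}"
  morphisms residue Abs_padic_int
  using prime_card_int[where 'a = 'p] by (intro exI[of _ "\<lambda>_. 0"]) (auto simp: prime_gt_0_int)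

setup_lifting type_definition_padic_int

lemma card_pow_pos [simp]: "0 < int CARD('p :: prime_card) ^ n"
  using prime_card_int[where 'a = 'p] by (simp add: prime_gt_0_int)

lemma mod_Suc_pow [simp]:
  "(x mod int CARD('p :: prime_card) ^ Suc n) mod int CARD('p) ^ n = x mod int CARD('p) ^ n"
  by (rule mod_mod_cancel) simp

lemma mod_mult_card_pow [simp]:
  "(x mod (int CARD('p :: prime_card) * int CARD('p) ^ n)) mod int CARD('p) ^ n
     = x mod int CARD('p) ^ n"
  using mod_Suc_pow[of x n, where 'p = 'p] by simp

instantiation padic_int :: (prime_card) comm_ring_1
begin

lift_definition zero_padic_int :: "'a padic_int" is "\<lambda>_. 0" by simp

lift_definition one_padic_int :: "'a padic_int" is "\<lambda>n. 1 mod int CARD('a) ^ n" by simp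

lift_definition plus_padic_int :: "'a padic_int \<Rightarrow> 'a padic_int \<Rightarrow> 'a padic_int"
  is "\<lambda>f g n. (f n + g n) mod int CARD('a) ^ n"
  by (auto, metis mod_add_eq)

lift_definition uminus_padic_int :: "'a padic_int \<Rightarrow> 'a padic_int"
  is "\<lambda>f n. (- f n) mod int CARD('a) ^ n"
  by (auto, metis mod_minus_eq)

lift_definition minus_padic_int :: "'a padic_int \<Rightarrow> 'a padic_int \<Rightarrow> 'a padic_int"
  is "\<lambda>f g n. (f n - g n) mod int CARD('a) ^ n"
  by (auto, metis mod_diff_eq)

lift_definition times_padic_int :: "'a padic_int \<Rightarrow> 'a padic_int \<Rightarrow> 'a padic_int"
  is "\<lambda>f g n. (f n * g n) mod int CARD('a) ^ n"
  by (auto, metis mod_mult_eq)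

instance
proof
  fix a b c :: "'a padic_int"
  show "a * b * c = a * (b * c)"
    by transfer (simp add: mod_mult_left_eq mod_mult_right_eq mult.assoc)
  show "a * b = b * a"
    by transfer (simp add: mult.commute)
  show "1 * a = a"
    by transfer (rule ext, simp add: mod_mult_left_eq)
  show "a + b + c = a + (b + c)"
    by transfer (simp add: mod_add_left_eq mod_add_right_eq add.assoc)
  show "a + b = b + a"
    by transfer (simp add: add.commute)
  show "0 + a = a"
    by transfer (rule ext, simp)
  show "- a + a = 0"
    by transfer (simp add: mod_add_left_eq)
  show "a - b = a + - b"
    by transfer (simp add: mod_add_right_eq)
  show "(a + b) * c = a * c + b * c"
    by transfer (simp add: mod_mult_left_eq mod_add_eq distrib_right)
  show "(0 :: 'a padic_int) \<noteq> 1"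
  proof
    assume "(0 :: 'a padic_int) = 1"
    hence "residue (0 :: 'a padic_int) 1 = residue (1 :: 'a padic_int) 1" by simp
    thus False
      using prime_gt_1_int[OF prime_card_int[where 'a = 'a]]
      by (simp add: zero_padic_int.rep_eq one_padic_int.rep_eq)
  qed
qed

end

lemma residue_mod:
  fixes x :: "'p :: prime_card padic_int"
  shows "residue x (n + k) mod int CARD('p) ^ n = residue x n"
proof (induction k)
  case 0
  show ?case using residue[of x] by simp
next
  case (Suc k)
  have "residue x (n + Suc k) mod int CARD('p) ^ n
        = residue x (Suc (n + k)) mod int CARD('p) ^ (n + k) mod int CARD('p) ^ n"
    by (simp add: mod_mod_cancel power_add)
  also have "\<dots> = residue x (n + k) mod int CARD('p) ^ n"
    using residue[of x] by simp
  finally show ?case using Suc.IH by simp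
qed

lemma prime_pow_add_dvd_multD:
  fixes q a b :: int
  assumes "prime q" "q ^ (m + k) dvd a * b"
  shows "q ^ m dvd a \<or> q ^ k dvd b"
proof (cases "a = 0 \<or> b = 0")
  case False
  hence "m + k \<le> multiplicity q (a * b)"
    using assms by (intro multiplicity_geI) auto
  also have "\<dots> = multiplicity q a + multiplicity q b"
    using assms False by (intro prime_elem_multiplicity_mult_distrib) auto
  finally have "m \<le> multiplicity q a \<or> k \<le> multiplicity q b" by linarith
  thus ?thesis by (auto intro: multiplicity_dvd')
qed auto

instance padic_int :: (prime_card) idom
proof
  fix a b :: "'a padic_int"
  assume "a \<noteq> 0" "b \<noteq> 0"
  then obtain m k where mk: "residue a m \<noteq> 0" "residue b k \<noteq> 0"
    by (metis residue_inject zero_padic_int.rep_eq ext)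
  show "a * b \<noteq> 0"
  proof
    assume "a * b = 0"
    hence "residue (a * b) (m + k) = 0" by (simp add: zero_padic_int.rep_eq)
    hence "int CARD('a) ^ (m + k) dvd residue a (m + k) * residue b (m + k)"
      by (simp add: times_padic_int.rep_eq mod_eq_0_iff_dvd)
    hence "int CARD('a) ^ m dvd residue a (m + k) \<or> int CARD('a) ^ k dvd residue b (m + k)"
      by (rule prime_pow_add_dvd_multD[OF prime_card_int])
    thus False
      using mk residue_mod[of a m k] residue_mod[of b k m]
      by (auto simp: add.commute[of k m] simp flip: mod_eq_0_iff_dvd)
  qed
qed

type_synonym 'p padic = "'p padic_int fract"

text \<open>All fields and modules below live inside a fixed algebraic closure of the $p$-adic numbers.\<close>

type_synonym 'p padic_closure = "'p padic alg_closure"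

definition of_padic_int :: "'p :: prime_card padic_int \<Rightarrow> 'p padic_closure" where
  "of_padic_int r = to_ac (Fract r 1)"


section \<open>Exterior squares over the $p$-adic integers\<close>

text \<open>
  For a $\mathbb{Z}_p$-submodule \<open>M\<close> of the algebraic closure, the exterior square is the
  free module on \<open>M \<times> M\<close> modulo the bilinearity relations and the elements
  \<open>(x, x)\<close>. Its elements are represented as cosets.
\<close>

definition scale :: "'p padic_int \<Rightarrow> ('b \<Rightarrow>\<^sub>0 'p :: prime_card padic_int) \<Rightarrow> ('b \<Rightarrow>\<^sub>0 'p padic_int)" where
  "scale r f = Poly_Mapping.map (\<lambda>s. r * s) f"

lemma lookup_scale [simp]: "Poly_Mapping.lookup (scale r f) k = r * Poly_Mapping.lookup f k"
  by (simp add: scale_def Poly_Mapping.map.rep_eq when_def)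

interpretation free: Modules.module scale
  by standard (auto intro!: poly_mapping_eqI simp: Poly_Mapping.lookup_add algebra_simps)

abbreviation gen :: "'b \<Rightarrow> 'b \<Rightarrow> 'b \<times> 'b \<Rightarrow>\<^sub>0 'p :: prime_card padic_int" where
  "gen x y \<equiv> Poly_Mapping.single (x, y) 1"

type_synonym 'p tensors = "'p padic_closure \<times> 'p padic_closure \<Rightarrow>\<^sub>0 'p padic_int"

definition ext_relations :: "'p :: prime_card padic_closure set \<Rightarrow> 'p tensors set" where
  "ext_relations M = free.span
     ({gen (x + x') y - gen x y - gen x' y | x x' y. x \<in> M \<and> x' \<in> M \<and> y \<in> M} \<union>
      {gen x (y + y') - gen x y - gen x y' | x y y'. x \<in> M \<and> y \<in> M \<and> y' \<in> M} \<union>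
      {gen (of_padic_int r * x) y - scale r (gen x y) | r x y. x \<in> M \<and> y \<in> M} \<union>
      {gen x (of_padic_int r * y) - scale r (gen x y) | r x y. x \<in> M \<and> y \<in> M} \<union>
      {gen x x | x. x \<in> M})"

definition ext_class :: "'p :: prime_card padic_closure set \<Rightarrow> 'p tensors \<Rightarrow> 'p tensors set" where
  "ext_class M f = {f + g | g. g \<in> ext_relations M}"

definition ext_square :: "'p :: prime_card padic_closure set \<Rightarrow> 'p tensors set set" where
  "ext_square M = {ext_class M f | f. Poly_Mapping.keys f \<subseteq> M \<times> M}"

definition wedge ::
  "'p :: prime_card padic_closure set \<Rightarrow> 'p padic_closure \<Rightarrow> 'p padic_closure \<Rightarrow> 'p tensors set" where
  "wedge M x y = ext_class M (gen x y)"

definition ext_add :: "'p :: prime_card tensors set \<Rightarrow> 'p tensors set \<Rightarrow> 'p tensors set" where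
  "ext_add A B = {f + g | f g. f \<in> A \<and> g \<in> B}"

definition ext_scale ::
  "'p :: prime_card padic_closure set \<Rightarrow> 'p padic_int \<Rightarrow> 'p tensors set \<Rightarrow> 'p tensors set" where
  "ext_scale M r A = (\<Union>f\<in>A. ext_class M (scale r f))"

text \<open>
  The $\mathbb{Z}_p$-linear maps from the exterior square of \<open>M\<close> to \<open>N\<close>. They are
  extensional, so that maps agreeing on the exterior square are equal.
\<close>

definition ext_hom ::
  "'p :: prime_card padic_closure set \<Rightarrow> 'p padic_closure set \<Rightarrow> ('p tensors set \<Rightarrow> 'p padic_closure) set" where
  "ext_hom M N = {\<gamma> \<in> ext_square M \<rightarrow>\<^sub>E N.
     (\<forall>A\<in>ext_square M. \<forall>B\<in>ext_square M. \<gamma> (ext_add A B) = \<gamma> A + \<gamma> B) \<and>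
     (\<forall>r. \<forall>A\<in>ext_square M. \<gamma> (ext_scale M r A) = of_padic_int r * \<gamma> A)}"

text \<open>
  The natural map between exterior squares induced by an inclusion $M \subseteq N$ enlarges
  each coset to a coset of the relations of \<open>N\<close>.
\<close>

definition ext_inclusion ::
  "'p :: prime_card padic_closure set \<Rightarrow> 'p tensors set \<Rightarrow> 'p tensors set" where
  "ext_inclusion N A = (\<Union>f\<in>A. ext_class N f)"


section \<open>The cyclotomic field and its ring of integers\<close>

definition primitive_root_of_unity :: "nat \<Rightarrow> 'a :: field \<Rightarrow> bool" where
  "primitive_root_of_unity n z \<longleftrightarrow> z ^ n = 1 \<and> (\<forall>k. 0 < k \<and> k < n \<longrightarrow> z ^ k \<noteq> 1)"

definition is_subfield :: "'a :: field set \<Rightarrow> bool" where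
  "is_subfield F \<longleftrightarrow> 0 \<in> F \<and> 1 \<in> F \<and>
     (\<forall>x\<in>F. \<forall>y\<in>F. x + y \<in> F \<and> x * y \<in> F) \<and> (\<forall>x\<in>F. - x \<in> F \<and> inverse x \<in> F)"

definition is_ideal :: "'a :: comm_ring_1 set \<Rightarrow> 'a set \<Rightarrow> bool" where
  "is_ideal R I \<longleftrightarrow> I \<subseteq> R \<and> 0 \<in> I \<and> (\<forall>x\<in>I. \<forall>y\<in>I. x + y \<in> I) \<and> (\<forall>r\<in>R. \<forall>x\<in>I. r * x \<in> I)"

definition ideal_generated :: "'a :: comm_ring_1 set \<Rightarrow> 'a set \<Rightarrow> 'a set" where
  "ideal_generated R S = \<Inter> {I. is_ideal R I \<and> S \<subseteq> I}"

record 'a lie_struct = "'a partial_object" +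
  plus_of :: "'a \<Rightarrow> 'a \<Rightarrow> 'a"
  bracket_of :: "'a \<Rightarrow> 'a \<Rightarrow> 'a"

context
  fixes \<theta> :: "'p :: prime_card padic_closure"
begin

definition cyc_field :: "'p padic_closure set" where
  "cyc_field = \<Inter> {F. is_subfield F \<and> range to_ac \<subseteq> F \<and> \<theta> \<in> F}"

definition integers :: "'p padic_closure set" where
  "integers = {x \<in> cyc_field. \<exists>f :: 'p padic_int poly.
     lead_coeff f = 1 \<and> poly (map_poly of_padic_int f) x = 0}"

definition kappa :: "'p padic_closure" where
  "kappa = \<theta> - 1"

definition ppow :: "enat \<Rightarrow> 'p padic_closure set" where
  "ppow n = (case n of enat k \<Rightarrow> {kappa ^ k * x | x. x \<in> integers} | \<infinity> \<Rightarrow> {0})"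

definition unit_group :: "'p padic_closure set" where
  "unit_group = integers - ppow 1"

definition gal :: "int \<Rightarrow> 'p padic_closure \<Rightarrow> 'p padic_closure" where
  "gal j = (THE s. s \<in> extensional cyc_field \<and> bij_betw s cyc_field cyc_field \<and>
     (\<forall>x\<in>cyc_field. \<forall>y\<in>cyc_field. s (x + y) = s x + s y \<and> s (x * y) = s x * s y) \<and>
     (\<forall>r. s (to_ac r) = to_ac r) \<and>
     s \<theta> = \<theta> powi j)"

text \<open>
  Since $K \otimes_{\mathbb{Z}_p} K = K \otimes_{\mathbb{Q}_p} K$, the exterior square of the
  field $K$ over $\mathbb{Z}_p$ is also its exterior square over $\mathbb{Q}_p$.
\<close>

definition vartheta :: "int \<Rightarrow> 'p tensors set \<Rightarrow> 'p padic_closure" where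
  "vartheta a = (THE t. t \<in> ext_hom cyc_field cyc_field \<and>
     (\<forall>x\<in>cyc_field. \<forall>y\<in>cyc_field. t (wedge cyc_field x y) =
        gal a x * gal (1 - a) y - gal (1 - a) x * gal a y))"

definition scaled_vartheta :: "nat \<Rightarrow> 'p padic_closure \<Rightarrow> int \<Rightarrow> 'p tensors set \<Rightarrow> 'p padic_closure" where
  "scaled_vartheta i c a =
     (\<lambda>A \<in> ext_square (ppow (enat i)). c * vartheta a (ext_inclusion cyc_field A))"

definition H :: "nat \<Rightarrow> ('p tensors set \<Rightarrow> 'p padic_closure) set" where
  "H i = {\<gamma> \<in> ext_hom (ppow (enat i)) (ppow (enat (2 * i + 1))).
     \<forall>x\<in>ppow (enat i). \<forall>y\<in>ppow (enat i).
       \<gamma> (wedge (ppow (enat i)) (\<theta> * x) (\<theta> * y)) = \<theta> * \<gamma> (wedge (ppow (enat i)) x y)}"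

definition H_hat :: "nat \<Rightarrow> ('p tensors set \<Rightarrow> 'p padic_closure) set" where
  "H_hat i = {\<gamma> \<in> H i. \<gamma> ` ext_square (ppow (enat i)) = ppow (enat (2 * i + 1))}"

definition jacobi ::
  "nat \<Rightarrow> ('p tensors set \<Rightarrow> 'p padic_closure) \<Rightarrow>
   'p padic_closure \<Rightarrow> 'p padic_closure \<Rightarrow> 'p padic_closure \<Rightarrow> 'p padic_closure" where
  "jacobi i \<gamma> u v w = (let b = (\<lambda>x y. \<gamma> (wedge (ppow (enat i)) x y))
     in b (b u v) w + b (b v w) u + b (b w u) v)"

definition jacobi_ideal :: "nat \<Rightarrow> ('p tensors set \<Rightarrow> 'p padic_closure) \<Rightarrow> 'p padic_closure set" where
  "jacobi_ideal i \<gamma> = ideal_generated integers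
     {jacobi i \<gamma> u v w | u v w. u \<in> ppow (enat i) \<and> v \<in> ppow (enat i) \<and> w \<in> ppow (enat i)}"

definition lam :: "nat \<Rightarrow> ('p tensors set \<Rightarrow> 'p padic_closure) \<Rightarrow> enat" where
  "lam i \<gamma> = (THE l. jacobi_ideal i \<gamma> = ppow l)"

definition pcoset :: "enat \<Rightarrow> 'p padic_closure \<Rightarrow> 'p padic_closure set" where
  "pcoset m x = {x + z | z. z \<in> ppow m}"

definition L ::
  "nat \<Rightarrow> enat \<Rightarrow> ('p tensors set \<Rightarrow> 'p padic_closure) \<Rightarrow> 'p padic_closure set lie_struct" where
  "L i m \<gamma> = \<lparr> carrier = pcoset m ` ppow (enat i),
     plus_of = (\<lambda>A B. \<Union>x\<in>A. \<Union>y\<in>B. pcoset m (x + y)),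
     bracket_of = (\<lambda>A B. \<Union>x\<in>A. \<Union>y\<in>B. pcoset m (\<gamma> (wedge (ppow (enat i)) x y))) \<rparr>"

end

end

theory Submission
  imports Defs "Jordan_Normal_Form.Char_Poly"
begin

text \<open>
  With \<open>\<kappa> = \<theta> - 1\<close> and \<open>R = \<int>\<^sub>p[\<kappa>]\<close>, the relation \<open>(1 + \<kappa>)\<^sup>p = 1\<close> makes \<open>\<kappa>\<close> a uniformizer of \<open>R\<close>
  with residue field \<open>F\<^sub>p\<close>, so that \<open>R\<close> is the ring of integers. An automorphism \<open>\<sigma>\<^sub>j\<close> multiplies the
  leading coefficient of an element of \<open>\<kappa>\<^sup>n R\<close> by \<open>j\<^sup>n\<close>. Put \<open>b = 1 - a\<close>. The Jacobi expression of
  \<open>c \<vartheta>\<^sub>a\<close> is \<open>c\<close> times a sum of two \<open>3 \<times> 3\<close> determinants in the conjugates under \<open>a\<^sup>2, a b, b\<close> and under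
  \<open>b\<^sup>2, a b, a\<close>. It is trilinear and alternating, hence lies in \<open>\<kappa>\<^sup>3\<^sup>i\<^sup>+\<^sup>3 R\<close>, and its leading coefficients at
  powers of \<open>\<kappa>\<close> are generalized Vandermonde determinants modulo \<open>p\<close>. Those at
  \<open>(i, i + 1, i + 2)\<close> and \<open>(i, i + 2, i + 3)\<close> cannot both vanish, and for \<open>p = 5\<close> the first one does not.
\<close>

section \<open>Units and factorization in the p-adic integers\<close>

text \<open>\<open>R\<close> enters as a ring of polynomial values without a topology, so
  \<open>1 - \<kappa> * s\<close> cannot be inverted by a convergent series. Integrality does it
  instead: a truncated geometric sum turns the element into \<open>1 - p * t\<close>, and a monic
  equation of \<open>t\<close> makes that a divisor of a p-adic integer congruent to 1 modulo
  \<open>p\<close>. The objects \<open>gal\<close>, \<open>vartheta\<close> and \<open>lam\<close>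
  are definite descriptions, so each calls for existence and uniqueness. For \<open>gal\<close>,
  existence rests on the linear independence of the powers of \<open>\<kappa>\<close> below
  \<open>p - 1\<close>. The bound \<open>y \<le> 2\<close> is the exponent sum
  \<open>i + (i + 2) + (i + 3) = 3 * i + 5\<close>. The intermediate triple
  \<open>(i, i + 1, i + 3)\<close> yields nothing new: its determinants carry the sum of the three
  bases as an extra factor, and both \<open>a * a + a * b + b\<close> and
  \<open>b * b + a * b + a\<close> equal 1 because \<open>a + b = 1\<close>. Its leading coefficient
  therefore coincides with that of \<open>(i, i + 1, i + 2)\<close>.\<close>

lemma residue_bounds: "0 \<le> residue x n" "residue (x :: 'p :: prime_card padic_int) n < int CARD('p) ^ n"
  using residue[of x] by auto

lemma residue_coherent: "residue (x :: 'p :: prime_card padic_int) (Suc n) mod int CARD('p) ^ n = residue x n"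
  using residue[of x] by auto

lemma padic_int_eqI: "(\<And>n. residue x n = residue y n) \<Longrightarrow> x = y"
  by (metis residue_inject ext)

lemma residue_of_nat: "residue (of_nat k :: 'p :: prime_card padic_int) n = int k mod int CARD('p) ^ n"
  by (induction k) (auto simp: zero_padic_int.rep_eq one_padic_int.rep_eq plus_padic_int.rep_eq mod_simps)

lemma residue_of_int: "residue (of_int k :: 'p :: prime_card padic_int) n = k mod int CARD('p) ^ n"
  by (cases k rule: int_cases2)
     (auto simp: residue_of_nat uminus_padic_int.rep_eq mod_simps)

lemma coprime_card_pow:
  "\<not> int CARD('p :: prime_card) dvd k \<Longrightarrow> coprime k (int CARD('p) ^ n)"
  using prime_card_int[where 'a = 'p] prime_imp_coprime[of "int CARD('p)" k]
  by (simp add: ac_simps)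

text \<open>Each residue of \<open>x\<close> is coprime to its modulus, hence invertible there;
  uniqueness of inverses modulo \<open>p ^ n\<close> makes the levelwise inverses coherent.\<close>

lemma padic_unit:
  fixes x :: "'p :: prime_card padic_int"
  assumes "residue x 1 \<noteq> 0"
  shows "x dvd 1"
proof -
  let ?q = "int CARD('p)"
  have nd: "\<not> ?q dvd residue x (Suc n)" for n
  proof
    assume "?q dvd residue x (Suc n)"
    hence "residue x (1 + n) mod ?q ^ 1 = 0" by simp
    with residue_mod[of x 1 n] assms show False by simp
  qed
  have cop: "coprime (residue x n) (?q ^ n)" for n
    using coprime_card_pow[OF nd[of "n - 1"], of n] by (cases n) auto
  have "\<exists>y. 0 \<le> y \<and> y < ?q ^ n \<and> [residue x n * y = 1] (mod ?q ^ n)" for n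
  proof -
    from cong_solve_coprime_int[OF cop[of n]] obtain y where "[residue x n * y = 1] (mod ?q ^ n)" by auto
    thus ?thesis
      by (intro exI[of _ "y mod ?q ^ n"]) (auto simp: cong_def mod_simps)
  qed
  then obtain y where y: "\<And>n. 0 \<le> y n" "\<And>n. y n < ?q ^ n" "\<And>n. [residue x n * y n = 1] (mod ?q ^ n)"
    by metis
  have coh: "y (Suc n) mod ?q ^ n = y n" for n
  proof -
    have "[residue x (Suc n) * y (Suc n) = 1] (mod ?q ^ n)"
      using y(3)[of "Suc n"] by (rule cong_dvd_modulus) simp
    moreover have "[residue x (Suc n) = residue x n] (mod ?q ^ n)"
      using residue_coherent[of x n] residue_bounds[of x n] by (auto simp: cong_def)
    ultimately have "[residue x n * y (Suc n) = 1] (mod ?q ^ n)"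
      by (meson cong_scalar_right cong_sym cong_trans)
    hence "[residue x n * y (Suc n) = residue x n * y n] (mod ?q ^ n)"
      using y(3)[of n] cong_sym cong_trans by blast
    hence "[y (Suc n) = y n] (mod ?q ^ n)"
      using cop[of n] by (simp add: cong_mult_lcancel)
    thus ?thesis using y(1,2)[of n] by (auto simp: cong_def)
  qed
  define z :: "'p padic_int" where "z = Abs_padic_int y"
  have "residue z = y"
    unfolding z_def using y coh by (subst Abs_padic_int_inverse) auto
  hence "x * z = 1"
    using y(3) by (intro padic_int_eqI) (auto simp: times_padic_int.rep_eq one_padic_int.rep_eq cong_def)
  thus ?thesis by (metis dvdI)
qed

lemma padic_divide_p:
  fixes x :: "'p :: prime_card padic_int"
  assumes "residue x 1 = 0"
  shows "of_nat CARD('p) dvd x"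
proof -
  let ?q = "int CARD('p)"
  \<comment> \<open>Dividing by \<open>p\<close> loses one level of precision, so level
    \<open>n\<close> of the quotient is read off from level \<open>Suc n\<close> of
    \<open>x\<close>.\<close>
  define y where "y n = residue x (Suc n) div ?q" for n
  have dv: "?q dvd residue x (Suc n)" for n
    using residue_mod[of x 1 n] assms by auto
  have xy: "residue x (Suc n) = ?q * y n" for n
    using dv[of n] by (simp add: y_def)
  have q0: "0 < ?q" using prime_card_int[where 'a='p] prime_gt_0_int by blast
  have y1: "0 \<le> y n" for n using residue_bounds(1)[of x "Suc n"] xy[of n] q0
    by (metis zero_le_mult_iff not_le)
  have y2: "y n < ?q ^ n" for n using residue_bounds(2)[of x "Suc n"] xy[of n] q0 by simp
  have y3: "y (Suc n) mod ?q ^ n = y n" for n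
  proof -
    have "?q * (y (Suc n) mod ?q ^ n) = (?q * y (Suc n)) mod (?q * ?q ^ n)"
      by (simp only: mult_mod_right)
    also have "\<dots> = ?q * y n"
      using residue_coherent[of x "Suc n"] xy by simp
    finally show ?thesis using q0 by simp
  qed
  define z :: "'p padic_int" where "z = Abs_padic_int y"
  have rz: "residue z = y"
    unfolding z_def using y1 y2 y3 by (subst Abs_padic_int_inverse) auto
  have "x = of_nat CARD('p) * z"
  proof (rule padic_int_eqI)
    fix n
    have "residue (of_nat CARD('p) * z) n = ?q * y n mod ?q ^ n"
      by (simp add: times_padic_int.rep_eq residue_of_nat rz mod_simps)
    also have "\<dots> = residue x n"
      using residue_coherent[of x n] xy by simp
    finally show "residue x n = residue (of_nat CARD('p) * z) n" ..
  qed
  thus ?thesis by simp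
qed

lemma padic_decomp:
  fixes x :: "'p :: prime_card padic_int"
  obtains y where "x = of_int (residue x 1) + of_nat CARD('p) * y"
proof -
  have "residue (x - of_int (residue x 1)) 1 = 0"
    using residue_bounds[of x 1] by (simp add: minus_padic_int.rep_eq residue_of_int mod_simps)
  from padic_divide_p[OF this] that show ?thesis
    by (metis add.commute diff_add_cancel dvdE)
qed

lemma padic_factor:
  fixes x :: "'p :: prime_card padic_int"
  assumes "x \<noteq> 0"
  obtains m u where "x = of_nat CARD('p) ^ m * u" "u dvd 1"
proof -
  let ?q = "int CARD('p)"
  \<comment> \<open>A level \<open>n\<close> with nonzero residue bounds how often \<open>p\<close>
    can be split off, so the extraction runs by induction on \<open>n\<close>.\<close>
  have "\<exists>m u. x = of_nat CARD('p) ^ m * u \<and> u dvd 1" if "residue x n \<noteq> 0" for n and x :: "'p padic_int"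
    using that
  proof (induction n arbitrary: x)
    case 0
    thus ?case using residue_bounds[of x 0] by simp
  next
    case (Suc n)
    show ?case
    proof (cases "residue x 1 = 0")
      case False
      thus ?thesis using padic_unit[of x] by (intro exI[of _ 0] exI[of _ x]) auto
    next
      case True
      from padic_divide_p[OF this] obtain y where y: "x = of_nat CARD('p) * y" by (auto elim: dvdE)
      have "residue y n \<noteq> 0"
      proof
        assume "residue y n = 0"
        hence "residue y (Suc n) mod ?q ^ n = 0" using residue_coherent[of y n] by simp
        hence "?q ^ Suc n dvd ?q * residue y (Suc n)" by (simp add: mod_eq_0_iff_dvd)
        hence "residue x (Suc n) = 0"
          by (simp add: y times_padic_int.rep_eq residue_of_nat mod_simps)
        with Suc.prems show False by simp
      qed
      from Suc.IH[OF this] obtain m u where "y = of_nat CARD('p) ^ m * u" "u dvd 1" by auto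
      thus ?thesis using y by (intro exI[of _ "Suc m"] exI[of _ u]) (auto simp: ac_simps)
    qed
  qed
  moreover from assms obtain n where "residue x n \<noteq> 0"
    by (metis padic_int_eqI zero_padic_int.rep_eq)
  ultimately show ?thesis using that by blast
qed

lemma padic_p_not_unit: "\<not> (of_nat CARD('p) :: 'p :: prime_card padic_int) dvd 1"
proof
  assume "(of_nat CARD('p) :: 'p padic_int) dvd 1"
  then obtain y :: "'p padic_int" where "1 = of_nat CARD('p) * y" by (auto elim: dvdE)
  hence "residue (1 :: 'p padic_int) 1 = residue (of_nat CARD('p) * y) 1" by simp
  thus False using prime_gt_1_int[OF prime_card_int[where 'a='p]]
    by (simp add: one_padic_int.rep_eq times_padic_int.rep_eq residue_of_nat)
qed

lemma padic_p_nonzero: "(of_nat CARD('p) :: 'p :: prime_card padic_int) \<noteq> 0"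
proof
  assume "(of_nat CARD('p) :: 'p padic_int) = 0"
  hence "residue (of_nat CARD('p) :: 'p padic_int) 2 = residue (0 :: 'p padic_int) 2" by simp
  hence "int CARD('p) ^ 2 dvd int CARD('p)"
    by (simp add: residue_of_nat zero_padic_int.rep_eq mod_eq_0_iff_dvd)
  hence "int CARD('p) ^ 2 \<le> int CARD('p)"
    by (rule zdvd_imp_le) (use prime_card_int[where 'a='p] prime_gt_0_int in blast)
  thus False using prime_gt_1_int[OF prime_card_int[where 'a='p]]
    by (simp add: power2_eq_square)
qed

interpretation of_padic: comm_ring_hom of_padic_int
  by standard (simp_all add: of_padic_int_def flip: to_ac_add to_ac_mult One_fract_def Zero_fract_def)

lemma of_padic_int_inj [simp]: "of_padic_int x = of_padic_int y \<longleftrightarrow> x = y"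
  by (simp add: of_padic_int_def eq_fract)

interpretation of_padic: inj_comm_ring_hom of_padic_int
  by standard (metis of_padic_int_inj of_padic.hom_zero)

interpretation to_ac: field_hom to_ac
  by standard simp_all

text \<open>A nonzero denominator is a power of \<open>p\<close> times a unit, and the unit moves
  into the numerator.\<close>

lemma to_ac_padic_cases:
  fixes r :: "'p :: prime_card padic"
  obtains s n where "to_ac r = of_padic_int s / of_nat CARD('p) ^ n"
proof (cases r)
  case (Fract a b)
  from padic_factor[OF this(2)] obtain m u where b: "b = of_nat CARD('p) ^ m * u" "u dvd 1" .
  from b(2) obtain v where v: "1 = u * v" by (auto elim: dvdE)
  have u0: "u \<noteq> 0" using v by auto
  have pn: "(of_nat CARD('p) :: 'p padic_int) ^ m \<noteq> 0"
    using padic_p_nonzero[where 'p = 'p] by simp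
  have "r = Fract (a * v) 1 / of_nat CARD('p) ^ m"
  proof -
    have *: "(of_nat CARD('p) ^ m :: 'p padic) = Fract (of_nat CARD('p) ^ m) 1"
      by (metis of_nat_fract of_nat_power)
    have "a = a * u * v" using v by (simp add: mult.assoc)
    thus ?thesis unfolding * Fract b(1) using u0 pn by (auto simp: eq_fract ac_simps)
  qed
  hence "to_ac r = of_padic_int (a * v) / of_nat CARD('p) ^ m"
    by (simp add: of_padic_int_def)
  thus ?thesis using that by blast
qed

section \<open>Evaluation of polynomials over the p-adic integers, and integrality\<close>

abbreviation pev :: "'p :: prime_card padic_int poly \<Rightarrow> 'p padic_closure \<Rightarrow> 'p padic_closure" where
  "pev f x \<equiv> poly (map_poly of_padic_int f) x"

lemma pev_pCons [simp]: "pev (pCons a f) x = of_padic_int a + x * pev f x"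
  by (simp add: of_padic.map_poly_pCons_hom)

lemma pev_add [simp]: "pev (f + g) x = pev f x + pev g x"
  by (simp add: of_padic.map_poly_hom_add)

lemma pev_uminus [simp]: "pev (- f) x = - pev f x"
  by (metis pev_add add.right_inverse minus_unique map_poly_0 poly_0)

lemma pev_smult [simp]: "pev (Polynomial.smult a f) x = of_padic_int a * pev f x"
  by (simp add: of_padic.map_poly_hom_smult)

lemma pev_mult [simp]: "pev (f * g) x = pev f x * pev g x"
  by (induction f) (auto simp: algebra_simps)

lemma pev_monom [simp]: "pev (Polynomial.monom a n) x = of_padic_int a * x ^ n"
  by (simp add: map_poly_monom poly_monom)

lemma pev_sum [simp]: "pev (sum f A) x = (\<Sum>k\<in>A. pev (f k) x)"
  by (induction A rule: infinite_finite_induct) auto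

lemma pev_of_padic: "pev f (of_padic_int r) = of_padic_int (poly f r)"
  by (induction f) (auto simp: of_padic.hom_add of_padic.hom_mult)

lemma pev_altdef: "pev f x = (\<Sum>k\<le>Polynomial.degree f. of_padic_int (poly.coeff f k) * x ^ k)"
  by (simp add: poly_altdef coeff_map_poly)

text \<open>Multiply the monic equation of \<open>z = 1 / x\<close> by \<open>x ^ d\<close>: the
  leading term becomes 1 and every other term keeps a factor \<open>x\<close>. An element with
  integral inverse is thus a unit in the ring it generates.\<close>

lemma integral_inverse:
  assumes "lead_coeff f = 1" "pev f z = 0" "x * z = 1"
  shows "\<exists>g. 1 = x * pev g x"
proof -
  define d where "d = Polynomial.degree f"
  have xzk: "x ^ k * z ^ k = 1" for k using assms(3) by (simp flip: power_mult_distrib)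
  hence xz: "x ^ d * z ^ k = x ^ (d - k)" if "k \<le> d" for k
  proof -
    have "x ^ d = x ^ (d - k) * x ^ k" using that by (simp flip: power_add)
    thus ?thesis using xzk[of k] by (simp add: mult.assoc)
  qed
  have "0 = x ^ d * (\<Sum>k\<le>d. of_padic_int (poly.coeff f k) * z ^ k)"
    using assms(2) unfolding pev_altdef d_def by simp
  also have "\<dots> = (\<Sum>k\<le>d. of_padic_int (poly.coeff f k) * x ^ (d - k))"
    unfolding sum_distrib_left by (intro sum.cong refl) (simp add: xz mult.left_commute)
  also have "\<dots> = 1 + (\<Sum>k<d. of_padic_int (poly.coeff f k) * x ^ (d - k))"
    using assms(1) by (simp add: d_def flip: lessThan_Suc_atMost)
  also have "(\<Sum>k<d. of_padic_int (poly.coeff f k) * x ^ (d - k)) =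
      x * (\<Sum>k<d. of_padic_int (poly.coeff f k) * x ^ (d - k - 1))"
    unfolding sum_distrib_left
    by (intro sum.cong refl) (auto simp: mult.left_commute Suc_diff_Suc simp flip: power_Suc)
  also have "(\<Sum>k<d. of_padic_int (poly.coeff f k) * x ^ (d - k - 1)) =
      pev (\<Sum>k<d. Polynomial.monom (poly.coeff f k) (d - k - 1)) x" (is "_ = pev ?g x")
    by (simp add: poly_monom)
  finally have "1 = x * pev (- ?g) x" by (simp add: eq_neg_iff_add_eq_0)
  thus ?thesis by blast
qed

text \<open>Factors \<open>x\<close> are split off until the constant coefficient is nonzero. In
  \<open>R_factor\<close> this bounds the \<open>\<kappa>\<close>-adic order of a nonzero
  element.\<close>

lemma integral_constant_multiple:
  assumes "f \<noteq> 0" "pev f x = 0" "x \<noteq> 0"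
  shows "\<exists>a h. a \<noteq> 0 \<and> of_padic_int a = x * pev h x"
  using assms
proof (induction f)
  case (pCons a f)
  show ?case
  proof (cases "a = 0")
    case False
    have "of_padic_int a = x * pev (- f) x" using pCons.prems by (simp add: eq_neg_iff_add_eq_0)
    thus ?thesis using False by blast
  qed (use pCons in auto)
qed auto

section \<open>The ring of integers of the cyclotomic field\<close>

locale cyclotomic =
  fixes \<theta> :: "'p :: prime_card padic_closure"
  assumes primitive: "primitive_root_of_unity CARD('p) \<theta>"
begin

abbreviation \<kappa> :: "'p padic_closure" where "\<kappa> \<equiv> kappa \<theta>"

definition R :: "'p padic_closure set" where "R = range (\<lambda>f. pev f \<kappa>)"

definition P :: "nat \<Rightarrow> 'p padic_closure set" where "P n = (*) (\<kappa> ^ n) ` R"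

lemma prime_p: "prime CARD('p)" "1 < CARD('p)"
  using prime_card[where 'a = 'p] prime_gt_1_nat by auto

lemma R_pev [simp, intro]: "pev f \<kappa> \<in> R"
  by (simp add: R_def)

lemma R_add [simp, intro]: "x \<in> R \<Longrightarrow> y \<in> R \<Longrightarrow> x + y \<in> R"
  by (auto simp: R_def simp flip: pev_add)

lemma R_mult [simp, intro]: "x \<in> R \<Longrightarrow> y \<in> R \<Longrightarrow> x * y \<in> R"
  by (auto simp: R_def simp flip: pev_mult)

lemma R_uminus [simp, intro]: "x \<in> R \<Longrightarrow> - x \<in> R"
  by (auto simp: R_def simp flip: pev_uminus)

lemma R_diff [simp, intro]: "x \<in> R \<Longrightarrow> y \<in> R \<Longrightarrow> x - y \<in> R"
  using R_add[of x "- y"] by auto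

lemma R_of_padic [simp, intro]: "of_padic_int r \<in> R"
  using R_pev[of "[:r:]"] by (simp del: R_pev)

lemma R_0 [simp, intro]: "0 \<in> R" and R_1 [simp]: "1 \<in> R"
  using R_of_padic[of 0] R_of_padic[of 1] by simp_all

lemma R_kappa [simp, intro]: "\<kappa> \<in> R"
  using R_pev[of "[:0, 1:]"] by (simp del: R_pev)

lemma R_of_int [simp, intro]: "of_int n \<in> R"
  using R_of_padic[of "of_int n"] by (simp del: R_of_padic add: of_padic.hom_of_int)

lemma R_of_nat [simp, intro]: "of_nat n \<in> R"
  using R_of_int[of "int n"] by (simp del: R_of_int)

lemma R_theta [simp, intro]: "\<theta> \<in> R"
  using R_add[OF R_kappa R_1] by (simp add: kappa_def)

lemma R_power [simp, intro]: "x \<in> R \<Longrightarrow> x ^ n \<in> R"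
  by (induction n) auto

lemma R_sum: "(\<And>k. k \<in> A \<Longrightarrow> f k \<in> R) \<Longrightarrow> sum f A \<in> R"
  by (induction A rule: infinite_finite_induct) auto

lemma R_pev_R [simp, intro]: "x \<in> R \<Longrightarrow> pev f x \<in> R"
  unfolding pev_altdef by (intro R_sum) auto

text \<open>Horner's scheme. The alternative \<open>y = 0\<close> plays the role of the zero
  polynomial, so one case covers both base and step, even for a \<open>Q\<close> that is not known
  at 0.\<close>

lemma R_induct [consumes 1, case_names step]:
  assumes "x \<in> R" and "\<And>r y. y \<in> R \<Longrightarrow> y = 0 \<or> Q y \<Longrightarrow> Q (of_padic_int r + \<kappa> * y)"
  shows "Q x"
proof -
  have "Q (pev f \<kappa>)" for f
  proof (induction f)
    case 0
    show ?case using assms(2)[of 0 0] by simp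
  next
    case (pCons a f)
    thus ?case using assms(2)[of "pev f \<kappa>" a] by simp
  qed
  thus ?thesis using assms(1) by (auto simp: R_def)
qed

section \<open>Total ramification of p, units and the local ring R\<close>

lemma kappa_nonzero [simp]: "\<kappa> \<noteq> 0"
  using primitive prime_p by (auto simp: kappa_def primitive_root_of_unity_def)

lemma of_nat_p_nonzero [simp]: "(of_nat CARD('p) :: 'p padic_closure) \<noteq> 0"
  using padic_p_nonzero[where 'p = 'p] of_padic.hom_0_iff[of "of_nat CARD('p) :: 'p padic_int"]
  by (simp add: of_padic.hom_of_nat)

lemma kappa_power_sum: "\<kappa> ^ (CARD('p) - 1) = - (\<Sum>k<CARD('p) - 1. of_nat (CARD('p) choose Suc k) * \<kappa> ^ k)"
proof -
  have "1 = (\<kappa> + 1) ^ CARD('p)"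
    using primitive by (simp add: kappa_def primitive_root_of_unity_def)
  also have "\<dots> = (\<Sum>k\<le>CARD('p). of_nat (CARD('p) choose k) * \<kappa> ^ k)"
    by (simp add: binomial_ring)
  also have "\<dots> = 1 + (\<Sum>k<CARD('p). of_nat (CARD('p) choose Suc k) * \<kappa> ^ Suc k)"
    by (simp add: sum.atMost_shift)
  also have "{..<CARD('p)} = insert (CARD('p) - 1) {..<CARD('p) - 1}"
    using prime_p(2) by auto
  also have "(\<Sum>k\<in>insert (CARD('p) - 1) {..<CARD('p) - 1}. of_nat (CARD('p) choose Suc k) * \<kappa> ^ Suc k) =
      \<kappa> * (\<kappa> ^ (CARD('p) - 1) + (\<Sum>k<CARD('p) - 1. of_nat (CARD('p) choose Suc k) * \<kappa> ^ k))"
    using prime_p(2) by (simp add: sum_distrib_left algebra_simps)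
  finally show ?thesis by (simp add: eq_neg_iff_add_eq_0)
qed

text \<open>The Eisenstein shape of the relation: \<open>p\<close> divides all binomial coefficients
  in the sum, and the constant term is exactly \<open>p\<close>, so the cofactor of \<open>p\<close>
  is \<open>1 + \<kappa> * s\<close> up to sign.\<close>

lemma kappa_power: "\<exists>s\<in>R. \<kappa> ^ (CARD('p) - 1) = - of_nat CARD('p) * (1 + \<kappa> * s)"
proof -
  define m where "m k = (CARD('p) choose k) div CARD('p)" for k
  have m: "CARD('p) choose k = CARD('p) * m k" if "0 < k" "k < CARD('p)" for k
    using dvd_choose_prime[of k "CARD('p)"] that prime_p by (simp add: m_def)
  obtain q where q: "CARD('p) - 1 = Suc q" using prime_p(2) by (metis Suc_diff_1 not_gr0 zero_less_diff)
  have "(\<Sum>k<CARD('p) - 1. of_nat (CARD('p) choose Suc k) * \<kappa> ^ k) =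
      of_nat CARD('p) + (\<Sum>k<q. of_nat (CARD('p) choose Suc (Suc k)) * \<kappa> ^ Suc k)"
    unfolding q sum.lessThan_Suc_shift by simp
  also have "(\<Sum>k<q. of_nat (CARD('p) choose Suc (Suc k)) * \<kappa> ^ Suc k) =
      (\<Sum>k<q. of_nat CARD('p) * \<kappa> * (of_nat (m (Suc (Suc k))) * \<kappa> ^ k))"
  proof (intro sum.cong refl)
    fix k assume "k \<in> {..<q}"
    hence "CARD('p) choose Suc (Suc k) = CARD('p) * m (Suc (Suc k))" using q by (intro m) auto
    thus "of_nat (CARD('p) choose Suc (Suc k)) * \<kappa> ^ Suc k =
      of_nat CARD('p) * \<kappa> * (of_nat (m (Suc (Suc k))) * \<kappa> ^ k)" by (simp add: algebra_simps)
  qed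
  also have "\<dots> = of_nat CARD('p) * \<kappa> * (\<Sum>k<q. of_nat (m (Suc (Suc k))) * \<kappa> ^ k)"
    by (simp add: sum_distrib_left)
  finally have "\<kappa> ^ (CARD('p) - 1) = - of_nat CARD('p) * (1 + \<kappa> * (\<Sum>k<q. of_nat (m (Suc (Suc k))) * \<kappa> ^ k))"
    unfolding kappa_power_sum by (simp add: algebra_simps)
  moreover have "(\<Sum>k<q. of_nat (m (Suc (Suc k))) * \<kappa> ^ k) \<in> R"
    by (intro R_sum R_mult R_power) auto
  ultimately show ?thesis by blast
qed

lemma R_coordinates:
  assumes "x \<in> R"
  shows "\<exists>c. x = (\<Sum>k<CARD('p) - 1. of_padic_int (c k) * \<kappa> ^ k)"
  using assms
proof (induction rule: R_induct)
  case (step r y)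
  obtain q where q: "CARD('p) - 1 = Suc q" using prime_p(2) by (metis Suc_diff_1 not_gr0 zero_less_diff)
  have "\<exists>c. y = (\<Sum>k<CARD('p) - 1. of_padic_int (c k) * \<kappa> ^ k)"
  proof (cases "y = 0")
    case True
    thus ?thesis by (intro exI[of _ "\<lambda>_. 0"]) simp
  qed (use step in auto)
  then obtain c where c: "y = (\<Sum>k<CARD('p) - 1. of_padic_int (c k) * \<kappa> ^ k)" ..
  define b :: "nat \<Rightarrow> 'p padic_int" where "b k = of_nat (CARD('p) choose Suc k)" for k
  define d where "d k = (case k of 0 \<Rightarrow> r | Suc j \<Rightarrow> c j)" for k
  have "of_padic_int r + \<kappa> * y =
      of_padic_int r + (\<Sum>k<q. of_padic_int (c k) * \<kappa> ^ Suc k) + of_padic_int (c q) * \<kappa> ^ (CARD('p) - 1)"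
    unfolding c q by (simp add: sum_distrib_left algebra_simps)
  also have "of_padic_int r + (\<Sum>k<q. of_padic_int (c k) * \<kappa> ^ Suc k) = (\<Sum>k<CARD('p) - 1. of_padic_int (d k) * \<kappa> ^ k)"
    unfolding q sum.lessThan_Suc_shift by (simp add: d_def)
  also have "of_padic_int (c q) * \<kappa> ^ (CARD('p) - 1) = - (\<Sum>k<CARD('p) - 1. of_padic_int (c q * b k) * \<kappa> ^ k)"
    unfolding kappa_power_sum
    by (simp add: b_def sum_distrib_left of_padic.hom_mult of_padic.hom_of_nat mult.assoc)
  finally have "of_padic_int r + \<kappa> * y = (\<Sum>k<CARD('p) - 1. of_padic_int (d k - c q * b k) * \<kappa> ^ k)"
    by (simp add: of_padic.hom_minus of_padic.hom_mult algebra_simps sum_subtractf)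
  thus ?case by (rule exI[of _ "\<lambda>k. d k - c q * b k"])
qed

text \<open>\<open>x\<close> is an eigenvalue of the matrix of multiplication by \<open>x\<close> on the powers of \<open>\<kappa>\<close>.\<close>

lemma R_integral:
  assumes "x \<in> R"
  shows "\<exists>f. lead_coeff f = 1 \<and> pev f x = 0"
proof -
  define n where "n = CARD('p) - 1"
  have n0: "0 < n" using prime_p(2) by (simp add: n_def)
  have "\<forall>k. \<exists>c. x * \<kappa> ^ k = (\<Sum>j<n. of_padic_int (c j) * \<kappa> ^ j)"
    unfolding n_def using assms by (intro allI R_coordinates R_mult R_power R_kappa)
  then obtain c where c: "\<And>k. x * \<kappa> ^ k = (\<Sum>j<n. of_padic_int (c k j) * \<kappa> ^ j)"
    by metis
  define A where "A = mat n n (\<lambda>(k, j). c k j)"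
  define v where "v = vec n (\<lambda>j. \<kappa> ^ j)"
  have A: "A \<in> carrier_mat n n" "map_mat of_padic_int A \<in> carrier_mat n n" by (auto simp: A_def)
  have "v $ 0 \<noteq> 0\<^sub>v n $ 0" using n0 by (simp add: v_def)
  hence "v \<noteq> 0\<^sub>v n" by auto
  moreover have "map_mat of_padic_int A *\<^sub>v v = x \<cdot>\<^sub>v v"
    by (rule eq_vecI) (auto simp: A_def v_def scalar_prod_def c atLeast0LessThan intro!: sum.cong)
  ultimately have "eigenvector (map_mat of_padic_int A) v x"
    by (auto simp: eigenvector_def A_def v_def)
  hence "poly (char_poly (map_mat of_padic_int A)) x = 0"
    using eigenvalue_root_char_poly[OF A(2)] unfolding eigenvalue_def by blast
  hence "pev (char_poly A) x = 0"
    by (simp add: of_padic.char_poly_hom[OF A(1)])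
  thus ?thesis using degree_monic_char_poly[OF A(1)] by auto
qed

text \<open>An integral inverse of \<open>p\<close> would, by \<open>integral_inverse\<close> at
  \<open>x = p\<close>, write 1 as \<open>p\<close> times a polynomial value at \<open>p\<close>,
  which is an equation inside the p-adic integers.\<close>

lemma p_not_unit: "z \<in> R \<Longrightarrow> of_nat CARD('p) * z \<noteq> 1"
proof
  assume "z \<in> R" "of_nat CARD('p) * z = 1"
  with R_integral[of z] integral_inverse[of _ z "of_nat CARD('p)"] obtain g :: "'p padic_int poly"
    where "1 = of_nat CARD('p) * pev g (of_nat CARD('p))" by metis
  also have "\<dots> = of_padic_int (of_nat CARD('p) * poly g (of_nat CARD('p)))"
    by (simp add: of_padic.hom_mult of_padic.hom_of_nat flip: pev_of_padic)
  finally have "(1 :: 'p padic_int) = of_nat CARD('p) * poly g (of_nat CARD('p))"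
    by (metis of_padic.hom_1_iff)
  thus False using padic_p_not_unit[where 'p = 'p] by (metis dvdI)
qed

lemma kappa_not_unit: "y \<in> R \<Longrightarrow> \<kappa> * y \<noteq> 1"
proof
  assume y: "y \<in> R" "\<kappa> * y = 1"
  from kappa_power obtain s where s: "s \<in> R" "\<kappa> ^ (CARD('p) - 1) = - of_nat CARD('p) * (1 + \<kappa> * s)" by blast
  have "1 = (\<kappa> * y) ^ (CARD('p) - 1)" using y by simp
  also have "\<dots> = of_nat CARD('p) * (- (1 + \<kappa> * s) * y ^ (CARD('p) - 1))"
    unfolding power_mult_distrib s(2) by (simp add: algebra_simps)
  finally show False
    using p_not_unit[of "- (1 + \<kappa> * s) * y ^ (CARD('p) - 1)"] s(1) y(1)
    by (metis R_1 R_add R_kappa R_mult R_power R_uminus)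
qed

text \<open>With \<open>f\<close> a monic equation of \<open>t\<close>, the p-adic integer
  \<open>N = p ^ d * f (1 / p)\<close> is congruent to 1 modulo \<open>p\<close>, hence a unit.
  Subtracting \<open>p ^ d * f t = 0\<close> leaves terms with factors
  \<open>1 - (p * t) ^ k\<close>, so \<open>1 - p * t\<close> divides a unit.\<close>

lemma unit_one_minus_p:
  assumes "t \<in> R"
  shows "\<exists>y\<in>R. (1 - of_nat CARD('p) * t) * y = 1"
proof -
  obtain f where f: "lead_coeff f = 1" "pev f t = 0" using R_integral[OF assms] by blast
  define d where "d = Polynomial.degree f"
  let ?c = "\<lambda>k. poly.coeff f k"
  define N where "N = (\<Sum>k\<le>d. ?c k * of_nat CARD('p) ^ (d - k))"
  define y where "y = (\<Sum>k\<le>d. of_padic_int (?c k) * of_nat CARD('p) ^ (d - k) * (\<Sum>j<k. (of_nat CARD('p) * t) ^ j))"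
  have "N = 1 + (\<Sum>k<d. ?c k * of_nat CARD('p) ^ (d - k))"
    using f(1) by (simp add: N_def d_def flip: lessThan_Suc_atMost)
  also have "(\<Sum>k<d. ?c k * of_nat CARD('p) ^ (d - k)) = of_nat CARD('p) * (\<Sum>k<d. ?c k * of_nat CARD('p) ^ (d - k - 1))"
    unfolding sum_distrib_left
    by (intro sum.cong refl) (auto simp: mult.left_commute Suc_diff_Suc simp flip: power_Suc)
  finally obtain m where "N = 1 + of_nat CARD('p) * m" by blast
  hence "residue N 1 \<noteq> 0" using prime_p(2)
    by (simp add: plus_padic_int.rep_eq times_padic_int.rep_eq one_padic_int.rep_eq residue_of_nat)
  then obtain v where v: "1 = N * v" using padic_unit[of N] by (auto elim: dvdE)
  have "0 = of_nat CARD('p) ^ d * pev f t" using f(2) by simp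
  also have "\<dots> = (\<Sum>k\<le>d. of_padic_int (?c k) * of_nat CARD('p) ^ (d - k) * (of_nat CARD('p) * t) ^ k)"
    unfolding pev_altdef sum_distrib_left d_def[symmetric]
    by (intro sum.cong refl) (auto simp: power_mult_distrib algebra_simps simp flip: power_add)
  finally have "of_padic_int N = (\<Sum>k\<le>d. of_padic_int (?c k) * of_nat CARD('p) ^ (d - k) * (1 - (of_nat CARD('p) * t) ^ k))"
    by (simp add: N_def of_padic.hom_sum of_padic.hom_mult of_padic.hom_power of_padic.hom_of_nat
        right_diff_distrib sum_subtractf)
  also have "\<dots> = (\<Sum>k\<le>d. (1 - of_nat CARD('p) * t) *
      (of_padic_int (?c k) * of_nat CARD('p) ^ (d - k) * (\<Sum>j<k. (of_nat CARD('p) * t) ^ j)))"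
    by (intro sum.cong refl) (simp only: one_diff_power_eq mult.left_commute)
  also have "\<dots> = (1 - of_nat CARD('p) * t) * y"
    unfolding y_def by (rule sum_distrib_left[symmetric])
  finally have "(1 - of_nat CARD('p) * t) * (y * of_padic_int v) = 1"
    using v by (metis mult.assoc of_padic.hom_mult of_padic.hom_one)
  moreover have "y \<in> R" unfolding y_def using assms by (intro R_sum R_mult R_power) auto
  ultimately show ?thesis by (auto intro!: bexI[of _ "y * of_padic_int v"])
qed

text \<open>The geometric sum stops after \<open>CARD('p) - 1\<close> terms because the remainder
  \<open>(\<kappa> * s) ^ (CARD('p) - 1)\<close> is a multiple of \<open>p\<close>, which leads back
  to \<open>unit_one_minus_p\<close>.\<close>

lemma unit_one_minus_kappa:
  assumes "s \<in> R"
  shows "\<exists>y\<in>R. (1 - \<kappa> * s) * y = 1"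
proof -
  from kappa_power obtain s' where s': "s' \<in> R" "\<kappa> ^ (CARD('p) - 1) = - of_nat CARD('p) * (1 + \<kappa> * s')" by blast
  define z where "z = (\<Sum>j<CARD('p) - 1. (\<kappa> * s) ^ j)"
  define t where "t = - (1 + \<kappa> * s') * s ^ (CARD('p) - 1)"
  have t: "t \<in> R" unfolding t_def using assms s'(1) by (intro R_mult R_uminus R_add R_power) auto
  have z: "z \<in> R" unfolding z_def using assms by (intro R_sum R_power R_mult) auto
  have "(1 - \<kappa> * s) * z = 1 - (\<kappa> * s) ^ (CARD('p) - 1)" by (simp add: z_def one_diff_power_eq)
  also have "\<dots> = 1 - of_nat CARD('p) * t"
    unfolding t_def power_mult_distrib s'(2) by (simp add: algebra_simps)
  finally have "(1 - \<kappa> * s) * z = 1 - of_nat CARD('p) * t" .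
  moreover obtain y where "y \<in> R" "(1 - of_nat CARD('p) * t) * y = 1" using unit_one_minus_p[OF t] by blast
  ultimately show ?thesis using z by (intro bexI[of _ "z * y"]) (auto simp: mult.assoc[symmetric])
qed

lemma p_associated: "\<exists>u\<in>R. \<exists>v\<in>R. u * v = 1 \<and> of_nat CARD('p) = \<kappa> ^ (CARD('p) - 1) * u"
proof -
  from kappa_power obtain s where s: "s \<in> R" "\<kappa> ^ (CARD('p) - 1) = - of_nat CARD('p) * (1 + \<kappa> * s)" by blast
  from unit_one_minus_kappa[of "- s"] s(1) obtain y where y: "y \<in> R" "(1 + \<kappa> * s) * y = 1" by auto
  have "of_nat CARD('p) = of_nat CARD('p) * ((1 + \<kappa> * s) * y)" using y by simp
  also have "\<dots> = \<kappa> ^ (CARD('p) - 1) * - y" unfolding s(2) by simp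
  finally have "of_nat CARD('p) = \<kappa> ^ (CARD('p) - 1) * - y" .
  moreover have "- y * - (1 + \<kappa> * s) = 1" using y by (simp only: minus_mult_minus mult.commute)
  moreover have "- y \<in> R" "- (1 + \<kappa> * s) \<in> R" using y s(1) by (simp_all del: minus_add_distrib)
  ultimately show ?thesis by blast
qed

lemma P_0 [simp]: "P 0 = R"
  by (auto simp: P_def)

text \<open>The constant coefficient modulo \<open>p\<close> decides: if it is nonzero, scaling by
  its inverse reduces \<open>x\<close> to the form \<open>1 + \<kappa> * s\<close>. So
  \<open>R\<close> is local with maximal ideal \<open>P 1\<close>.\<close>

lemma unit_or_P1:
  assumes "x \<in> R"
  shows "x \<in> P 1 \<or> (\<exists>y\<in>R. x * y = 1)"
proof -
  from assms obtain r s where x: "x = of_padic_int r + \<kappa> * s" "s \<in> R"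
  proof (induction rule: R_induct)
    case (step r y)
    thus ?case by blast
  qed
  show ?thesis
  proof (cases "residue r 1 = 0")
    case True
    then obtain r' where r: "r = of_nat CARD('p) * r'" using padic_divide_p by (auto elim: dvdE)
    from p_associated obtain u where u: "u \<in> R" "of_nat CARD('p) = \<kappa> ^ (CARD('p) - 1) * u" by blast
    obtain q where q: "CARD('p) - 1 = Suc q" using prime_p(2) by (metis Suc_diff_1 not_gr0 zero_less_diff)
    have "x = \<kappa> * (\<kappa> ^ q * u * of_padic_int r' + s)"
      by (simp add: x r of_padic.hom_mult of_padic.hom_of_nat u(2)[unfolded q] algebra_simps)
    moreover have "\<kappa> ^ q * u * of_padic_int r' + s \<in> R" using u x by (intro R_add R_mult R_power) auto
    ultimately show ?thesis by (auto simp: P_def)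
  next
    case False
    hence "r dvd 1" using padic_unit by blast
    then obtain v where v: "1 = r * v" by (elim dvdE)
    from unit_one_minus_kappa[of "- s * of_padic_int v"] x(2) obtain y
      where y: "y \<in> R" "(1 + \<kappa> * s * of_padic_int v) * y = 1" by (auto simp: mult.assoc R_mult R_uminus)
    have "x * of_padic_int v = 1 + \<kappa> * s * of_padic_int v"
      using v by (simp add: x distrib_right flip: of_padic.hom_mult)
    hence "x * (of_padic_int v * y) = 1" using y by (simp add: mult.assoc[symmetric])
    thus ?thesis using y by blast
  qed
qed

lemma P_mono: "m \<le> n \<Longrightarrow> P n \<subseteq> P m"
proof -
  assume "m \<le> n"
  then obtain k where "n = m + k" by (metis le_add_diff_inverse)
  thus ?thesis by (auto simp: P_def power_add mult.assoc R_mult R_power)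
qed

lemma P_cancel [simp]: "\<kappa> ^ n * x \<in> P (n + k) \<longleftrightarrow> x \<in> P k"
proof
  assume "\<kappa> ^ n * x \<in> P (n + k)"
  then obtain y where "y \<in> R" "\<kappa> ^ n * x = \<kappa> ^ n * (\<kappa> ^ k * y)" by (auto simp: P_def power_add mult.assoc)
  thus "x \<in> P k" by (auto simp: P_def)
qed (auto simp: P_def power_add mult.assoc)

lemma P_R: "x \<in> P n \<Longrightarrow> x \<in> R"
  by (auto simp: P_def R_mult R_power)

lemma P_add [intro]: "x \<in> P n \<Longrightarrow> y \<in> P n \<Longrightarrow> x + y \<in> P n"
  unfolding P_def by (auto simp flip: distrib_left)

lemma P_mult: "x \<in> P m \<Longrightarrow> y \<in> P n \<Longrightarrow> x * y \<in> P (m + n)"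
proof -
  assume "x \<in> P m" "y \<in> P n"
  then obtain a b where "a \<in> R" "b \<in> R" "x = \<kappa> ^ m * a" "y = \<kappa> ^ n * b" by (auto simp: P_def)
  thus ?thesis by (auto simp: P_def power_add mult_ac intro!: image_eqI[of _ _ "a * b"])
qed

lemma P_mult_R [intro]: "x \<in> R \<Longrightarrow> y \<in> P n \<Longrightarrow> x * y \<in> P n"
  using P_mult[of x 0 y n] by simp

lemma P_mult_R' [intro]: "x \<in> P n \<Longrightarrow> y \<in> R \<Longrightarrow> x * y \<in> P n"
  using P_mult[of x n y 0] by simp

lemma P_uminus [intro]: "x \<in> P n \<Longrightarrow> - x \<in> P n"
  using P_mult_R[of "-1" x n] R_uminus[of 1] by simp

lemma P_diff [intro]: "x \<in> P n \<Longrightarrow> y \<in> P n \<Longrightarrow> x - y \<in> P n"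
  using P_add[of x n "- y"] by auto

lemma P_zero [simp, intro]: "0 \<in> P n"
  by (auto simp: P_def intro!: image_eqI[of _ _ 0])

lemma P_kappa [simp, intro]: "\<kappa> ^ n \<in> P n"
  by (auto simp: P_def intro!: image_eqI[of _ _ 1])

lemma unit_iff: "x \<in> R \<Longrightarrow> (\<exists>y\<in>R. x * y = 1) \<longleftrightarrow> x \<notin> P 1"
proof -
  have False if "x \<in> P 1" "y \<in> R" "x * y = 1" for y
  proof -
    from that(1) obtain z where "z \<in> R" "x = \<kappa> * z" by (auto simp: P_def)
    with that kappa_not_unit[of "z * y"] show False by (auto simp: mult.assoc)
  qed
  thus "x \<in> R \<Longrightarrow> ?thesis" using unit_or_P1 by blast
qed

text \<open>A nonzero element divides a nonzero p-adic integer, hence some power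
  \<open>\<kappa> ^ N\<close>, and so lies outside \<open>P (Suc N)\<close>. Splitting off the
  largest possible power of \<open>\<kappa>\<close> leaves a cofactor outside
  \<open>P 1\<close>.\<close>

lemma R_factor:
  assumes "x \<in> R" "x \<noteq> 0"
  obtains n u where "u \<in> R" "u \<notin> P 1" "x = \<kappa> ^ n * u"
proof -
  from R_integral[OF assms(1)] obtain f where "lead_coeff f = 1" "pev f x = 0" by blast
  hence "f \<noteq> 0" "pev f x = 0" by auto
  from integral_constant_multiple[OF this assms(2)]
  obtain a h where ah: "a \<noteq> 0" "of_padic_int a = x * pev h x" by blast
  have h: "pev h x \<in> R" using assms(1) by simp
  from padic_factor[OF ah(1)] obtain m w where w: "a = of_nat CARD('p) ^ m * w" "w dvd 1" .
  from w(2) obtain w' where w': "1 = w * w'" by (auto elim: dvdE)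
  from p_associated obtain u v where u: "u \<in> R" "v \<in> R" "u * v = 1" "of_nat CARD('p) = \<kappa> ^ (CARD('p) - 1) * u" by blast
  define N where "N = (CARD('p) - 1) * m"
  have "x * (pev h x * of_padic_int w') = of_nat CARD('p) ^ m * of_padic_int (w * w')"
    by (simp add: mult.assoc[symmetric] of_padic.hom_mult of_padic.hom_power of_padic.hom_of_nat w(1) flip: ah(2))
  also have "\<dots> = \<kappa> ^ N * u ^ m" by (simp add: u(4) power_mult_distrib N_def power_mult flip: w')
  finally have "x * (pev h x * of_padic_int w') * v ^ m = \<kappa> ^ N * (u * v) ^ m"
    by (simp add: power_mult_distrib mult.assoc)
  hence "x * (pev h x * of_padic_int w' * v ^ m) = \<kappa> ^ N" by (simp add: u mult.assoc)
  moreover have "pev h x * of_padic_int w' * v ^ m \<in> R" using h u by (intro R_mult R_power) auto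
  ultimately obtain z where z: "z \<in> R" "x * z = \<kappa> ^ N" by blast
  have not: "x \<notin> P (Suc N)"
  proof
    assume "x \<in> P (Suc N)"
    hence "\<kappa> ^ N * 1 \<in> P (N + 1)" using z P_mult_R'[of x "Suc N" z] by simp
    hence "1 \<in> P 1" by (subst (asm) P_cancel)
    thus False using unit_iff[of 1] by auto
  qed
  define n where "n = (LEAST n. x \<notin> P (Suc n))"
  have n: "x \<notin> P (Suc n)" unfolding n_def by (rule LeastI[of "\<lambda>n. x \<notin> P (Suc n)", OF not])
  have "x \<in> P n"
  proof (cases n)
    case 0 thus ?thesis using assms by simp
  next
    case (Suc k)
    thus ?thesis using not_less_Least[of k "\<lambda>n. x \<notin> P (Suc n)"] by (auto simp: n_def)
  qed
  then obtain y where y: "y \<in> R" "x = \<kappa> ^ n * y" by (auto simp: P_def)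
  have "y \<notin> P 1" using n y P_cancel[of n y 1] by auto
  thus ?thesis using that y by blast
qed

section \<open>The cyclotomic field as fractions of R, and integral closure\<close>

lemma cyc_field_subfield: "is_subfield (cyc_field \<theta>)" "range to_ac \<subseteq> cyc_field \<theta>" "\<theta> \<in> cyc_field \<theta>"
  unfolding cyc_field_def by (auto simp: is_subfield_def)

lemma cyc_add [simp, intro]: "x \<in> cyc_field \<theta> \<Longrightarrow> y \<in> cyc_field \<theta> \<Longrightarrow> x + y \<in> cyc_field \<theta>"
  and cyc_mult [simp, intro]: "x \<in> cyc_field \<theta> \<Longrightarrow> y \<in> cyc_field \<theta> \<Longrightarrow> x * y \<in> cyc_field \<theta>"
  and cyc_uminus [simp, intro]: "x \<in> cyc_field \<theta> \<Longrightarrow> - x \<in> cyc_field \<theta>"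
  and cyc_inverse [simp, intro]: "x \<in> cyc_field \<theta> \<Longrightarrow> inverse x \<in> cyc_field \<theta>"
  and cyc_0 [simp, intro]: "0 \<in> cyc_field \<theta>" and cyc_1 [simp, intro]: "1 \<in> cyc_field \<theta>"
  and cyc_theta [simp, intro]: "\<theta> \<in> cyc_field \<theta>"
  and cyc_to_ac [simp, intro]: "to_ac r \<in> cyc_field \<theta>"
  using cyc_field_subfield by (auto simp: is_subfield_def)

lemma cyc_diff [simp, intro]: "x \<in> cyc_field \<theta> \<Longrightarrow> y \<in> cyc_field \<theta> \<Longrightarrow> x - y \<in> cyc_field \<theta>"
  using cyc_add[of x "- y"] by auto

lemma cyc_power [simp, intro]: "x \<in> cyc_field \<theta> \<Longrightarrow> x ^ n \<in> cyc_field \<theta>"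
  by (induction n) auto

lemma cyc_kappa [simp, intro]: "\<kappa> \<in> cyc_field \<theta>"
  unfolding kappa_def by (intro cyc_diff) auto

lemma cyc_of_padic [simp, intro]: "of_padic_int r \<in> cyc_field \<theta>"
  by (simp add: of_padic_int_def)

lemma R_cyc [simp, intro]: "x \<in> R \<Longrightarrow> x \<in> cyc_field \<theta>"
  by (induction rule: R_induct) auto

text \<open>Inverses exist among the fractions because \<open>R_factor\<close> makes a nonzero
  numerator a power of \<open>\<kappa>\<close> times a unit; p-adic numbers are covered because
  \<open>p\<close> is associated to a power of \<open>\<kappa>\<close>.\<close>

lemma cyc_field_eq: "cyc_field \<theta> = {y / \<kappa> ^ n | y n. y \<in> R}" (is "_ = ?F")
proof
  show "?F \<subseteq> cyc_field \<theta>"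
    by (auto simp: divide_inverse)
  have F: "y / \<kappa> ^ n \<in> ?F" if "y \<in> R" for y n using that by blast
  have "is_subfield ?F"
    unfolding is_subfield_def
  proof (intro conjI ballI)
    show "0 \<in> ?F" "1 \<in> ?F" using F[of 0 0] F[of 1 0] by auto
  next
    fix x y assume "x \<in> ?F" "y \<in> ?F"
    then obtain a b m n where ab: "a \<in> R" "b \<in> R" "x = a / \<kappa> ^ m" "y = b / \<kappa> ^ n" by blast
    have xy: "a * \<kappa> ^ n + b * \<kappa> ^ m \<in> R" "a * b \<in> R" using ab by auto
    have "x + y = (a * \<kappa> ^ n + b * \<kappa> ^ m) / \<kappa> ^ (m + n)"
      by (simp add: ab power_add add_divide_distrib)
    thus "x + y \<in> ?F" using F[OF xy(1)] by simp
    have "x * y = (a * b) / \<kappa> ^ (m + n)"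
      by (simp add: ab power_add)
    thus "x * y \<in> ?F" using F[OF xy(2)] by simp
  next
    fix x assume "x \<in> ?F"
    then obtain a m where a: "a \<in> R" "x = a / \<kappa> ^ m" by blast
    have "- x = (- a) / \<kappa> ^ m" by (simp add: a)
    thus "- x \<in> ?F" using a by (auto intro!: F simp del: divide_minus_left)
    show "inverse x \<in> ?F"
    proof (cases "x = 0")
      case True
      thus ?thesis using F[of 0 0] by simp
    next
      case False
      hence "a \<noteq> 0" using a by auto
      from R_factor[OF a(1) this] obtain n u where u: "u \<in> R" "u \<notin> P 1" "a = \<kappa> ^ n * u" .
      then obtain v where v: "v \<in> R" "u * v = 1" using unit_iff by blast
      have "u \<noteq> 0" using v by auto
      have "inverse x = (\<kappa> ^ m * v) / \<kappa> ^ n"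
        using v \<open>u \<noteq> 0\<close> by (simp add: a u field_simps)
      thus ?thesis using v by (auto intro!: F)
    qed
  qed
  moreover have "range to_ac \<subseteq> ?F"
  proof safe
    fix r :: "'p padic"
    obtain s n where r: "to_ac r = of_padic_int s / of_nat CARD('p) ^ n" by (rule to_ac_padic_cases)
    from p_associated obtain u v where u: "u \<in> R" "v \<in> R" "u * v = 1" "of_nat CARD('p) = \<kappa> ^ (CARD('p) - 1) * u" by blast
    have "u ^ n * v ^ n = 1" using u(3) by (simp flip: power_mult_distrib)
    hence "inverse (u ^ n) = v ^ n" by (rule inverse_unique)
    hence "to_ac r = (of_padic_int s * v ^ n) / \<kappa> ^ ((CARD('p) - 1) * n)"
      unfolding r u(4) by (simp add: power_mult_distrib divide_inverse mult_ac flip: power_mult)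
    thus "\<exists>y n. to_ac r = y / \<kappa> ^ n \<and> y \<in> R" using u by (metis R_mult R_of_padic R_power)
  qed
  moreover have "\<theta> \<in> ?F" using F[of \<theta> 0] by simp
  ultimately show "cyc_field \<theta> \<subseteq> ?F"
    unfolding cyc_field_def by blast
qed

lemma cyc_cases:
  assumes "x \<in> cyc_field \<theta>" "x \<notin> R"
  obtains n u where "0 < n" "u \<in> R" "u \<notin> P 1" "x = u / \<kappa> ^ n"
proof -
  from assms cyc_field_eq obtain y k where y: "y \<in> R" "x = y / \<kappa> ^ k" by auto
  have "y \<noteq> 0" using assms y by auto
  from R_factor[OF y(1) this] obtain n u where u: "u \<in> R" "u \<notin> P 1" "y = \<kappa> ^ n * u" .
  have "n < k"
  proof (rule ccontr)
    assume "\<not> n < k"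
    hence "x = \<kappa> ^ (n - k) * u" by (simp add: y u power_diff)
    thus False using assms u by auto
  qed
  hence "x = u / \<kappa> ^ (k - n)" by (simp add: y u power_diff)
  thus ?thesis using that u \<open>n < k\<close> by (metis zero_less_diff)
qed

text \<open>A field element outside \<open>R\<close> is \<open>u / \<kappa> ^ n\<close> with
  \<open>u\<close> a unit and \<open>n > 0\<close>. If it were integral,
  \<open>integral_inverse\<close> would make its inverse, a multiple of \<open>\<kappa>\<close>, a
  unit of \<open>R\<close>.\<close>

lemma integers_eq: "integers \<theta> = R"
proof
  show "R \<subseteq> integers \<theta>" using R_integral R_cyc by (auto simp: integers_def)
  show "integers \<theta> \<subseteq> R"
  proof
    fix x assume "x \<in> integers \<theta>"
    then obtain f :: "'p padic_int poly" where x: "x \<in> cyc_field \<theta>" "lead_coeff f = 1" "pev f x = 0"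
      by (auto simp: integers_def)
    show "x \<in> R"
    proof (rule ccontr)
      assume "x \<notin> R"
      from cyc_cases[OF x(1) this] obtain n u where u: "0 < n" "u \<in> R" "u \<notin> P 1" "x = u / \<kappa> ^ n" .
      then obtain v where v: "v \<in> R" "u * v = 1" using unit_iff by blast
      have "\<kappa> ^ n * v * x = 1" using v by (simp add: u mult.commute)
      from integral_inverse[OF x(2,3) this] obtain g where g: "1 = (\<kappa> ^ n * v) * pev g (\<kappa> ^ n * v)" by blast
      have "\<kappa> ^ n * v \<in> R" using v by auto
      hence "pev g (\<kappa> ^ n * v) \<in> R" by simp
      moreover obtain k where "n = Suc k" using u(1) by (cases n) auto
      ultimately show False using g v kappa_not_unit[of "\<kappa> ^ k * v * pev g (\<kappa> ^ n * v)"]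
        by (auto simp: mult.assoc R_mult R_power)
    qed
  qed
qed

lemma ppow_eq: "ppow \<theta> (enat n) = P n"
  by (auto simp: ppow_def integers_eq P_def)

lemma p_in_P1 [simp, intro]: "of_nat CARD('p) \<in> P 1"
proof -
  have "1 \<le> CARD('p) - 1" using prime_p(2) by simp
  moreover have "of_nat CARD('p) \<in> P (CARD('p) - 1)" using p_associated by (auto simp: P_def)
  ultimately show ?thesis using P_mono by blast
qed

lemma of_int_P1_iff: "of_int d \<in> P 1 \<longleftrightarrow> int CARD('p) dvd d"
proof
  assume "int CARD('p) dvd d"
  then obtain k where "d = int CARD('p) * k" by (elim dvdE)
  thus "of_int d \<in> P 1" using P_mult_R'[OF p_in_P1 R_of_int[of k]] by simp
next
  assume d: "of_int d \<in> P 1"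
  show "int CARD('p) dvd d"
  proof (rule ccontr)
    assume "\<not> int CARD('p) dvd d"
    from coprime_card_pow[OF this, of 1] obtain x where "[d * x = 1] (mod int CARD('p))"
      using cong_solve_coprime_int by auto
    then obtain y where "1 = d * x + int CARD('p) * y"
      by (metis cong_iff_lin cong_sym)
    hence "(1 :: 'p padic_closure) = of_int d * of_int x + of_nat CARD('p) * of_int y"
      by (metis of_int_1 of_int_add of_int_mult of_int_of_nat_eq)
    also have "\<dots> \<in> P 1"
      by (intro P_add P_mult_R' d p_in_P1) auto
    finally show False using unit_iff[of 1] by auto
  qed
qed

lemma of_padic_P1:
  obtains d where "of_padic_int r - of_int d \<in> P 1"
proof -
  obtain y where "r = of_int (residue r 1) + of_nat CARD('p) * y" by (rule padic_decomp)
  hence "of_padic_int r - of_int (residue r 1) = of_nat CARD('p) * of_padic_int y"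
    by (metis add_diff_cancel_left' of_padic.hom_add of_padic.hom_mult of_padic.hom_of_int of_padic.hom_of_nat)
  also have "\<dots> \<in> P 1" by (intro P_mult_R' p_in_P1) auto
  finally show ?thesis using that by blast
qed

lemma P_sum: "(\<And>k. k \<in> A \<Longrightarrow> f k \<in> P n) \<Longrightarrow> sum f A \<in> P n"
  by (induction A rule: infinite_finite_induct) auto

section \<open>Leading coefficients\<close>

text \<open>An integer \<open>d\<close> stands for a class in the residue field, so it matters only
  modulo \<open>p\<close>, and multiples of \<open>p\<close> are allowed. Cancellation of leading
  terms then becomes arithmetic of integers.\<close>

definition lead :: "nat \<Rightarrow> 'p padic_closure \<Rightarrow> int \<Rightarrow> bool" where
  "lead n x d \<longleftrightarrow> x - of_int d * \<kappa> ^ n \<in> P (Suc n)"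

lemma lead_in_P: "lead n x d \<Longrightarrow> x \<in> P n"
proof -
  assume "lead n x d"
  hence "x - of_int d * \<kappa> ^ n \<in> P n" using P_mono[of n "Suc n"] by (auto simp: lead_def)
  hence "(x - of_int d * \<kappa> ^ n) + of_int d * \<kappa> ^ n \<in> P n" by (intro P_add) auto
  thus ?thesis by simp
qed

lemma ex_lead:
  assumes "x \<in> P n"
  obtains d where "lead n x d"
proof -
  from assms obtain y where y: "y \<in> R" "x = \<kappa> ^ n * y" by (auto simp: P_def)
  from y(1) obtain r s where rs: "y = of_padic_int r + \<kappa> * s" "s \<in> R"
  proof (induction rule: R_induct)
    case (step r y)
    thus ?case by blast
  qed
  obtain d where d: "of_padic_int r - of_int d \<in> P 1" by (rule of_padic_P1)
  have "x - of_int d * \<kappa> ^ n = \<kappa> ^ n * ((of_padic_int r - of_int d) + \<kappa> * s)"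
    by (simp add: y rs algebra_simps)
  also have "\<kappa> * s \<in> P 1" using rs P_mult_R'[of \<kappa> 1 s] P_kappa[of 1] by simp
  with d have "\<kappa> ^ n * ((of_padic_int r - of_int d) + \<kappa> * s) \<in> P (n + 1)"
    by (subst P_cancel) auto
  finally show ?thesis using that by (simp add: lead_def)
qed

lemma lead_P_iff:
  assumes "lead n x d"
  shows "x \<in> P (Suc n) \<longleftrightarrow> int CARD('p) dvd d"
proof -
  have "x \<in> P (Suc n) \<longleftrightarrow> of_int d * \<kappa> ^ n \<in> P (Suc n)"
    using assms P_diff[of x "Suc n" "x - of_int d * \<kappa> ^ n"]
      P_add[of "x - of_int d * \<kappa> ^ n" "Suc n" "of_int d * \<kappa> ^ n"] by (auto simp: lead_def)
  also have "\<dots> \<longleftrightarrow> of_int d \<in> P 1"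
    using P_cancel[of n "of_int d" 1] by (simp add: mult.commute)
  finally show ?thesis by (simp only: of_int_P1_iff)
qed

lemma lead_zero: "x \<in> P (Suc n) \<Longrightarrow> lead n x 0"
  by (simp add: lead_def)

lemma lead_kappa [simp]: "lead n (\<kappa> ^ n) 1"
  by (simp add: lead_def)

lemma lead_add: "lead n x d \<Longrightarrow> lead n y e \<Longrightarrow> lead n (x + y) (d + e)"
  unfolding lead_def using P_add[of "x - of_int d * \<kappa> ^ n" "Suc n" "y - of_int e * \<kappa> ^ n"]
  by (simp add: algebra_simps)

lemma lead_diff: "lead n x d \<Longrightarrow> lead n y e \<Longrightarrow> lead n (x - y) (d - e)"
  unfolding lead_def using P_diff[of "x - of_int d * \<kappa> ^ n" "Suc n" "y - of_int e * \<kappa> ^ n"]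
  by (simp add: algebra_simps)

lemma lead_mult:
  assumes "lead m x d" "lead n y e"
  shows "lead (m + n) (x * y) (d * e)"
proof -
  have "x * y - of_int (d * e) * \<kappa> ^ (m + n) =
      (x - of_int d * \<kappa> ^ m) * y + of_int d * \<kappa> ^ m * (y - of_int e * \<kappa> ^ n)"
    by (simp add: power_add algebra_simps)
  also have "\<dots> \<in> P (Suc (m + n))"
  proof (rule P_add)
    have "x - of_int d * \<kappa> ^ m \<in> P (Suc m)" using assms(1) by (simp only: lead_def)
    from P_mult[OF this lead_in_P[OF assms(2)]]
    show "(x - of_int d * \<kappa> ^ m) * y \<in> P (Suc (m + n))" by simp
    have "y - of_int e * \<kappa> ^ n \<in> P (Suc n)" using assms(2) by (simp only: lead_def)
    moreover have "of_int d * \<kappa> ^ m \<in> P m" by (intro P_mult_R) auto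
    ultimately have "of_int d * \<kappa> ^ m * (y - of_int e * \<kappa> ^ n) \<in> P (m + Suc n)" by (intro P_mult)
    thus "of_int d * \<kappa> ^ m * (y - of_int e * \<kappa> ^ n) \<in> P (Suc (m + n))" by simp
  qed
  finally show ?thesis by (simp add: lead_def)
qed

lemma lead_one [simp]: "lead 0 1 1"
  using lead_kappa[of 0] by simp

lemma lead_power:
  assumes "lead m x d"
  shows "lead (m * n) (x ^ n) (d ^ n)"
proof (induction n)
  case (Suc n)
  show ?case using lead_mult[OF assms Suc.IH] by simp
qed simp

section \<open>Residue class counts\<close>

lemma pcoset_enat: "pcoset \<theta> (enat n) x = (\<lambda>z. x + z) ` P n"
  by (auto simp: pcoset_def ppow_eq)

lemma pcoset_eq_iff: "pcoset \<theta> (enat n) x = pcoset \<theta> (enat n) y \<longleftrightarrow> x - y \<in> P n"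
proof
  assume "pcoset \<theta> (enat n) x = pcoset \<theta> (enat n) y"
  moreover have "x + 0 \<in> pcoset \<theta> (enat n) x" unfolding pcoset_enat by (intro imageI) simp
  ultimately obtain z where "z \<in> P n" "x = y + z" by (auto simp: pcoset_enat)
  thus "x - y \<in> P n" by simp
next
  assume *: "x - y \<in> P n"
  have "x + z \<in> (\<lambda>z. y + z) ` P n" if "z \<in> P n" for z
    using P_add[OF * that] by (auto intro!: image_eqI[of _ _ "x - y + z"])
  moreover have "y + z \<in> (\<lambda>z. x + z) ` P n" if "z \<in> P n" for z
    using P_diff[OF that *] by (auto intro!: image_eqI[of _ _ "z - (x - y)"])
  ultimately show "pcoset \<theta> (enat n) x = pcoset \<theta> (enat n) y"
    unfolding pcoset_enat by blast
qed

lemma translate_pcoset: "(\<lambda>z. d + z) ` pcoset \<theta> (enat n) x = pcoset \<theta> (enat n) (d + x)"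
  by (auto simp: pcoset_enat image_image add.assoc)

text \<open>The leading digit splits \<open>P i\<close> into \<open>p\<close> translates of
  \<open>P (Suc i)\<close>. The modulus is unchanged since \<open>i + Suc k = Suc i + k\<close>,
  while \<open>i\<close> moves, hence the generalization over \<open>i\<close>.\<close>

lemma card_pcosets: "card (pcoset \<theta> (enat (i + k)) ` P i) = CARD('p) ^ k"
proof (induction k arbitrary: i)
  case 0
  have "pcoset \<theta> (enat (i + 0)) ` P i = {pcoset \<theta> (enat i) 0}"
    using pcoset_eq_iff[of i _ 0] by (auto intro!: image_eqI[of _ _ 0])
  thus ?case by simp
next
  case (Suc k)
  let ?A = "pcoset \<theta> (enat (Suc i + k)) ` P (Suc i)"
  let ?f = "\<lambda>(d, C). (\<lambda>z. of_nat d * \<kappa> ^ i + z) ` C"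
  have "?f ` ({..<CARD('p)} \<times> ?A) = pcoset \<theta> (enat (i + Suc k)) ` P i"
  proof (intro equalityI subsetI)
    fix C assume "C \<in> ?f ` ({..<CARD('p)} \<times> ?A)"
    then obtain d x where "x \<in> P (Suc i)" "C = pcoset \<theta> (enat (i + Suc k)) (of_nat d * \<kappa> ^ i + x)"
      by (auto simp: translate_pcoset)
    moreover from this have "of_nat d * \<kappa> ^ i + x \<in> P i" using P_mono[of i "Suc i"] by (intro P_add) auto
    ultimately show "C \<in> pcoset \<theta> (enat (i + Suc k)) ` P i" by blast
  next
    fix C assume "C \<in> pcoset \<theta> (enat (i + Suc k)) ` P i"
    then obtain x where x: "x \<in> P i" "C = pcoset \<theta> (enat (i + Suc k)) x" by blast
    obtain d where d: "lead i x d" using ex_lead[OF x(1)] by blast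
    define e where "e = nat (d mod int CARD('p))"
    have e: "e < CARD('p)" "int CARD('p) dvd d - int e"
      using prime_p(2) by (simp_all add: e_def nat_less_iff mod_eq_dvd_iff[symmetric])
    have "of_int (d - int e) * \<kappa> ^ i \<in> P (1 + i)"
      using e(2) by (intro P_mult) (simp_all only: of_int_P1_iff P_kappa)
    hence "(x - of_int d * \<kappa> ^ i) + of_int (d - int e) * \<kappa> ^ i \<in> P (Suc i)"
      using d by (intro P_add) (auto simp: lead_def)
    hence "x - of_nat e * \<kappa> ^ i \<in> P (Suc i)" by (simp add: algebra_simps)
    hence "(e, pcoset \<theta> (enat (Suc i + k)) (x - of_nat e * \<kappa> ^ i)) \<in> {..<CARD('p)} \<times> ?A"
      using e(1) by blast
    moreover have "C = ?f (e, pcoset \<theta> (enat (Suc i + k)) (x - of_nat e * \<kappa> ^ i))"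
      by (simp add: translate_pcoset x(2))
    ultimately show "C \<in> ?f ` ({..<CARD('p)} \<times> ?A)" by blast
  qed
  moreover have "inj_on ?f ({..<CARD('p)} \<times> ?A)"
  proof (rule inj_onI, clarify)
    fix d e x y
    assume d: "d < CARD('p)" "e < CARD('p)" and x: "x \<in> P (Suc i)" and y: "y \<in> P (Suc i)"
      and eq: "(\<lambda>z. of_nat d * \<kappa> ^ i + z) ` pcoset \<theta> (enat (Suc i + k)) x =
        (\<lambda>z. of_nat e * \<kappa> ^ i + z) ` pcoset \<theta> (enat (Suc i + k)) y"
    have 1: "(of_nat d * \<kappa> ^ i + x) - (of_nat e * \<kappa> ^ i + y) \<in> P (Suc i + k)"
      using eq by (simp only: translate_pcoset pcoset_eq_iff)
    have "(of_nat d * \<kappa> ^ i + x) - (of_nat e * \<kappa> ^ i + y) \<in> P (Suc i)"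
      using 1 P_mono[of "Suc i" "Suc i + k"] by auto
    from P_diff[OF this P_diff[OF x y]]
    have "\<kappa> ^ i * of_int (int d - int e) \<in> P (i + 1)" by (simp add: algebra_simps)
    hence "int CARD('p) dvd int d - int e" unfolding P_cancel of_int_P1_iff .
    hence de: "d = e" using d by (metis mod_eq_dvd_iff mod_less of_nat_eq_iff zmod_int)
    have "x - y \<in> P (Suc i + k)" using 1 by (simp add: de)
    thus "d = e \<and> pcoset \<theta> (enat (Suc i + k)) x = pcoset \<theta> (enat (Suc i + k)) y"
      using de by (simp add: pcoset_eq_iff)
  qed
  ultimately have "card (pcoset \<theta> (enat (i + Suc k)) ` P i) = card ({..<CARD('p)} \<times> ?A)"
    by (metis card_image)
  thus ?case using Suc.IH[of "Suc i"] by (simp add: card_cartesian_product)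
qed

section \<open>Galois automorphisms\<close>

text \<open>Exactly what the calculus of leading coefficients asks of an automorphism. The notion is
  closed under composition, with multipliers multiplied, so the composites in the Jacobi expression
  are covered too.\<close>

definition gal_like :: "('p padic_closure \<Rightarrow> 'p padic_closure) \<Rightarrow> int \<Rightarrow> bool" where
  "gal_like f j \<longleftrightarrow> (\<forall>x\<in>R. f x \<in> R) \<and>
     (\<forall>x\<in>R. \<forall>y\<in>R. f (x + y) = f x + f y \<and> f (x * y) = f x * f y) \<and>
     (\<forall>r. f (of_padic_int r) = of_padic_int r) \<and> lead 1 (f \<kappa>) j"

lemma gal_likeD:
  assumes "gal_like f j"
  shows "x \<in> R \<Longrightarrow> f x \<in> R" "x \<in> R \<Longrightarrow> y \<in> R \<Longrightarrow> f (x + y) = f x + f y"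
    "x \<in> R \<Longrightarrow> y \<in> R \<Longrightarrow> f (x * y) = f x * f y" "f (of_padic_int r) = of_padic_int r"
    "lead 1 (f \<kappa>) j" "f 0 = 0" "f 1 = 1" "f (of_int d) = of_int d"
proof -
  note * = assms[unfolded gal_like_def]
  show "x \<in> R \<Longrightarrow> f x \<in> R" "x \<in> R \<Longrightarrow> y \<in> R \<Longrightarrow> f (x + y) = f x + f y"
    "x \<in> R \<Longrightarrow> y \<in> R \<Longrightarrow> f (x * y) = f x * f y" "lead 1 (f \<kappa>) j"
    and r: "f (of_padic_int r) = of_padic_int r" for r
    using * by auto
  show "f 0 = 0" "f 1 = 1" "f (of_int d) = of_int d"
    using r[of 0] r[of 1] r[of "of_int d"] by (auto simp: of_padic.hom_of_int)
qed

lemma gal_like_diff: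
  assumes "gal_like f j" "x \<in> R" "y \<in> R"
  shows "f (x - y) = f x - f y"
  using gal_likeD(2)[OF assms(1), of "x - y" y] assms(2,3) by (simp add: algebra_simps)

lemma gal_like_power:
  assumes "gal_like f j" "x \<in> R"
  shows "f (x ^ n) = f x ^ n"
  by (induction n) (use gal_likeD[OF assms(1)] assms(2) in auto)

lemma gal_like_P:
  assumes "gal_like f j" "x \<in> P n"
  shows "f x \<in> P n"
proof -
  from assms(2) obtain y where y: "y \<in> R" "x = \<kappa> ^ n * y" by (auto simp: P_def)
  have "f x = f \<kappa> ^ n * f y"
    using y gal_likeD(3)[OF assms(1)] gal_like_power[OF assms(1)] by auto
  moreover have "lead (1 * n) (f \<kappa> ^ n) (j ^ n)" by (rule lead_power[OF gal_likeD(5)[OF assms(1)]])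
  hence "f \<kappa> ^ n \<in> P n" using lead_in_P by simp
  ultimately show ?thesis using y gal_likeD(1)[OF assms(1)] by auto
qed

lemma lead_gal_like:
  assumes "gal_like f j" "lead n x d"
  shows "lead n (f x) (j ^ n * d)"
proof -
  have x: "x \<in> R" using assms(2) lead_in_P P_R by blast
  have "f (x - of_int d * \<kappa> ^ n) \<in> P (Suc n)"
    by (rule gal_like_P[OF assms(1)]) (use assms(2) in \<open>simp add: lead_def\<close>)
  also have "f (x - of_int d * \<kappa> ^ n) = f x - of_int d * f \<kappa> ^ n"
    using x by (simp add: gal_like_diff[OF assms(1)] gal_likeD[OF assms(1)] gal_like_power[OF assms(1)])
  finally have 1: "lead n (f x - of_int d * f \<kappa> ^ n) 0" by (rule lead_zero)
  have "lead (1 * n) (f \<kappa> ^ n) (j ^ n)" by (rule lead_power[OF gal_likeD(5)[OF assms(1)]])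
  moreover have "lead 0 (of_int d) d" by (simp add: lead_def)
  ultimately have "lead n (of_int d * f \<kappa> ^ n) (d * j ^ n)" using lead_mult by fastforce
  from lead_add[OF 1 this] show ?thesis by (simp add: mult.commute)
qed

lemma gal_like_compose:
  assumes "gal_like f j" "gal_like g k"
  shows "gal_like (\<lambda>x. f (g x)) (j * k)"
proof -
  have "lead 1 (f (g \<kappa>)) (j ^ 1 * k)"
    by (rule lead_gal_like[OF assms(1) gal_likeD(5)[OF assms(2)]])
  thus ?thesis using gal_likeD[OF assms(1)] gal_likeD[OF assms(2)]
    by (auto simp: gal_like_def)
qed

text \<open>This is \<open>((X + 1) ^ p - 1) / X\<close>, the \<open>p\<close>-th cyclotomic
  polynomial shifted so that \<open>\<kappa>\<close> is a root.\<close>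

definition cyclo_poly :: "'p padic_int poly" where
  "cyclo_poly = (\<Sum>k<CARD('p). Polynomial.monom (of_nat (CARD('p) choose Suc k)) k)"

lemma pev_cyclo_poly: "x * pev cyclo_poly x = (x + 1) ^ CARD('p) - 1"
proof -
  have "(x + 1) ^ CARD('p) = (\<Sum>k\<le>CARD('p). of_nat (CARD('p) choose k) * x ^ k)"
    by (simp add: binomial_ring)
  also have "\<dots> = 1 + (\<Sum>k<CARD('p). of_nat (CARD('p) choose Suc k) * x ^ Suc k)"
    by (simp add: sum.atMost_shift)
  also have "(\<Sum>k<CARD('p). of_nat (CARD('p) choose Suc k) * x ^ Suc k) = x * pev cyclo_poly x"
    by (simp add: cyclo_poly_def poly_monom of_padic.hom_of_nat sum_distrib_left algebra_simps)
  finally show ?thesis by simp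
qed

lemma cyclo_poly_degree: "cyclo_poly \<noteq> 0" "Polynomial.degree cyclo_poly \<le> CARD('p) - 1"
proof -
  have "poly.coeff cyclo_poly (CARD('p) - 1) = 1"
    using prime_p(2) by (simp add: cyclo_poly_def coeff_sum)
  thus "cyclo_poly \<noteq> 0" by auto
  show "Polynomial.degree cyclo_poly \<le> CARD('p) - 1"
    unfolding cyclo_poly_def
    by (intro degree_sum_le) (auto intro!: order.trans[OF degree_monom_le])
qed

text \<open>The nonzero terms have valuations that are distinct modulo \<open>CARD('p) - 1\<close>.\<close>

lemma kappa_powers_independent:
  assumes "Polynomial.degree f < CARD('p) - 1 \<or> f = 0" "pev f \<kappa> = 0"
  shows "f = 0"
proof (rule ccontr)
  assume f: "f \<noteq> 0"
  define n where "n = CARD('p) - 1"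
  have dn: "Polynomial.degree f < n" using assms(1) f by (simp add: n_def)
  define A where "A = {k. k \<le> Polynomial.degree f \<and> poly.coeff f k \<noteq> 0}"
  have A: "finite A" "A \<noteq> {}" using f by (auto simp: A_def intro!: exI[of _ "Polynomial.degree f"])
  define t where "t k = of_padic_int (poly.coeff f k) * \<kappa> ^ k" for k
  have "\<exists>m. t k \<in> P (n * m + k) \<and> t k \<notin> P (Suc (n * m + k))" if "k \<in> A" for k
  proof -
    have "poly.coeff f k \<noteq> 0" using that by (simp add: A_def)
    from padic_factor[OF this] obtain m u where u: "poly.coeff f k = of_nat CARD('p) ^ m * u" "u dvd 1" .
    from u(2) obtain v where v: "1 = u * v" by (elim dvdE)
    from p_associated obtain w w' where w: "w \<in> R" "w' \<in> R" "w * w' = 1" "of_nat CARD('p) = \<kappa> ^ n * w"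
      unfolding n_def by blast
    have t: "t k = \<kappa> ^ (n * m + k) * (w ^ m * of_padic_int u)"
      by (simp add: t_def u(1) of_padic.hom_mult of_padic.hom_power of_padic.hom_of_nat w(4)
          power_mult_distrib power_add power_mult)
    have "(w ^ m * of_padic_int u) * (w' ^ m * of_padic_int v) = (w * w') ^ m * of_padic_int (u * v)"
      by (simp add: power_mult_distrib of_padic.hom_mult)
    also have "\<dots> = 1" using w(3) v by (metis mult_1 of_padic.hom_one power_one)
    finally have "w ^ m * of_padic_int u \<notin> P 1"
      using unit_iff[of "w ^ m * of_padic_int u"] w by blast
    hence "t k \<notin> P ((n * m + k) + 1)" unfolding t P_cancel .
    moreover have "t k \<in> P (n * m + k)" unfolding t using w by auto
    ultimately show ?thesis by auto
  qed
  then obtain m where m: "\<And>k. k \<in> A \<Longrightarrow> t k \<in> P (n * m k + k)"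
    "\<And>k. k \<in> A \<Longrightarrow> t k \<notin> P (Suc (n * m k + k))" by metis
  define v where "v k = n * m k + k" for k
  have mod: "v k mod n = k" if "k \<in> A" for k using that dn by (auto simp: v_def A_def)
  \<comment> \<open>Since valuations are distinct, this minimum is attained only at
    \<open>k\<close>, and the other terms cannot cancel \<open>t k\<close>.\<close>
  from ex_min_if_finite[of "v ` A"] A obtain k where k: "k \<in> A" "\<And>j. j \<in> A \<Longrightarrow> v k \<le> v j"
    by (metis (no_types, lifting) arg_min_least arg_min_if_finite(1))
  have "t j \<in> P (Suc (v k))" if "j \<in> A - {k}" for j
  proof -
    have "v k \<noteq> v j" using mod[of k] mod[of j] that k by auto
    hence "Suc (v k) \<le> v j" using k(2)[of j] that by auto
    thus ?thesis using m(1)[of j] that P_mono by (auto simp: v_def)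
  qed
  hence "sum t (A - {k}) \<in> P (Suc (v k))" by (intro P_sum)
  moreover have "0 = (\<Sum>j\<in>A. t j)"
    unfolding assms(2)[symmetric] pev_altdef t_def A_def
    by (intro sum.mono_neutral_right) auto
  hence "t k = - sum t (A - {k})"
    using A(1) k(1) by (simp add: sum.remove[of A k] eq_neg_iff_add_eq_0)
  ultimately have "t k \<in> P (Suc (v k))" by auto
  thus False using m(2)[OF k(1)] by (simp add: v_def)
qed

end

lemma pev_diff: "pev (f - g) x = pev f x - pev g x"
  using pev_add[of "f - g" g x] by simp

section \<open>Construction of the automorphisms by substitution\<close>

context cyclotomic
begin

text \<open>Denominators are powers of \<open>p\<close> instead of \<open>\<kappa>\<close> because
  automorphisms fix them; only the numerator has to be transformed.\<close>

lemma cyc_field_cases: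
  assumes "x \<in> cyc_field \<theta>"
  obtains f n where "x = pev f \<kappa> / of_nat CARD('p) ^ n"
proof -
  from assms obtain y n where y: "y \<in> R" "x = y / \<kappa> ^ n" by (auto simp: cyc_field_eq)
  from p_associated obtain u where u: "u \<in> R" "of_nat CARD('p) = \<kappa> ^ (CARD('p) - 1) * u" by blast
  define w where "w = \<kappa> ^ (CARD('p) - 2) * u"
  have "CARD('p) - 1 = Suc (CARD('p) - 2)" using prime_p(2) by simp
  hence p: "of_nat CARD('p) = \<kappa> * w" by (simp add: u(2) w_def del: diff_Suc_eq_diff_pred)
  have "w \<noteq> 0" using p of_nat_p_nonzero by auto
  hence "x = (y * w ^ n) / of_nat CARD('p) ^ n" by (simp add: y(2) p power_mult_distrib)
  moreover have "y * w ^ n \<in> R" using y u by (simp add: w_def)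
  then obtain f where "y * w ^ n = pev f \<kappa>" by (auto simp: R_def)
  ultimately show ?thesis using that by simp
qed

text \<open>Substitution of \<open>\<zeta> - 1\<close> for \<open>\<kappa>\<close>. The choice
  ranges over all representations as a fraction; for a nontrivial \<open>p\<close>-th root of unity
  \<open>\<zeta>\<close>, \<open>galois_map_fraction\<close> shows that they all give the same
  value.\<close>

definition galois_map :: "'p padic_closure \<Rightarrow> 'p padic_closure \<Rightarrow> 'p padic_closure" where
  "galois_map \<zeta> x = (SOME z. \<exists>f n. x = pev f \<kappa> / of_nat CARD('p) ^ n \<and>
     z = pev f (\<zeta> - 1) / of_nat CARD('p) ^ n)"

context
  fixes \<zeta> :: "'p padic_closure"
  assumes root: "\<zeta> ^ CARD('p) = 1" "\<zeta> \<noteq> 1"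
begin

text \<open>\<open>cyclo_poly\<close> vanishes at both points. The remainder of pseudo-division by
  it vanishes at \<open>\<kappa>\<close> and has degree below \<open>CARD('p) - 1\<close>, so it is
  zero by independence; the scalar \<open>a\<close> from pseudo-division is nonzero and
  cancels.\<close>

lemma pev_root_transfer:
  assumes "pev f \<kappa> = 0"
  shows "pev f (\<zeta> - 1) = 0"
proof -
  define r where "r = pseudo_mod f cyclo_poly"
  obtain a q where aq: "a \<noteq> 0" "Polynomial.smult a f = cyclo_poly * q + r"
    using pseudo_mod(1)[OF cyclo_poly_degree(1), of f] unfolding r_def by blast
  have r: "Polynomial.degree r < CARD('p) - 1 \<or> r = 0"
    using pseudo_mod(2)[OF cyclo_poly_degree(1), of f] cyclo_poly_degree(2) unfolding r_def by linarith
  have "\<theta> ^ CARD('p) = 1" using primitive by (simp add: primitive_root_of_unity_def)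
  hence "\<kappa> * pev cyclo_poly \<kappa> = 0" by (simp add: pev_cyclo_poly) (simp add: kappa_def)
  hence "pev cyclo_poly \<kappa> = 0" by simp
  hence "pev r \<kappa> = 0" using arg_cong[OF aq(2), of "\<lambda>f. pev f \<kappa>"] assms
    by (simp only: pev_smult pev_add pev_mult) simp
  hence "r = 0" using kappa_powers_independent r by blast
  moreover have "(\<zeta> - 1) * pev cyclo_poly (\<zeta> - 1) = 0" by (simp add: pev_cyclo_poly root)
  hence "pev cyclo_poly (\<zeta> - 1) = 0" using root by simp
  ultimately have "of_padic_int a * pev f (\<zeta> - 1) = 0"
    using arg_cong[OF aq(2), of "\<lambda>f. pev f (\<zeta> - 1)"] by (simp only: pev_smult pev_add pev_mult) simp
  thus ?thesis using aq(1) by simp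
qed

lemma galois_map_fraction:
  "galois_map \<zeta> (pev f \<kappa> / of_nat CARD('p) ^ n) = pev f (\<zeta> - 1) / of_nat CARD('p) ^ n"
  unfolding galois_map_def
proof (rule some_equality)
  fix z
  let ?q = "of_nat CARD('p) :: 'p padic_closure" and ?r = "of_nat CARD('p) :: 'p padic_int"
  assume "\<exists>g m. pev f \<kappa> / ?q ^ n = pev g \<kappa> / ?q ^ m \<and> z = pev g (\<zeta> - 1) / ?q ^ m"
  then obtain g m where gm: "pev f \<kappa> / ?q ^ n = pev g \<kappa> / ?q ^ m" "z = pev g (\<zeta> - 1) / ?q ^ m" by blast
  have "pev (Polynomial.smult (?r ^ m) f + - Polynomial.smult (?r ^ n) g) \<kappa> = 0"
    using gm(1) by (simp only: pev_add pev_uminus pev_smult of_padic.hom_power of_padic.hom_of_nat)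
      (simp add: field_simps)
  from pev_root_transfer[OF this] have "?q ^ m * pev f (\<zeta> - 1) = ?q ^ n * pev g (\<zeta> - 1)"
    by (simp only: pev_add pev_uminus pev_smult of_padic.hom_power of_padic.hom_of_nat) simp
  thus "z = pev f (\<zeta> - 1) / ?q ^ n" unfolding gm(2) by (simp add: field_simps)
qed blast

lemma galois_map_pev: "galois_map \<zeta> (pev f \<kappa>) = pev f (\<zeta> - 1)"
  using galois_map_fraction[of f 0] by simp

lemma galois_map_add:
  assumes "x \<in> cyc_field \<theta>" "y \<in> cyc_field \<theta>"
  shows "galois_map \<zeta> (x + y) = galois_map \<zeta> x + galois_map \<zeta> y"
proof -
  let ?q = "of_nat CARD('p) :: 'p padic_closure" and ?r = "of_nat CARD('p) :: 'p padic_int"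
  from assms obtain f n g m where x: "x = pev f \<kappa> / ?q ^ n" and y: "y = pev g \<kappa> / ?q ^ m"
    by (metis cyc_field_cases)
  define h where "h = Polynomial.smult (?r ^ m) f + Polynomial.smult (?r ^ n) g"
  have h: "pev h z / ?q ^ (n + m) = pev f z / ?q ^ n + pev g z / ?q ^ m" for z
    unfolding h_def pev_add pev_smult of_padic.hom_power of_padic.hom_of_nat
    by (simp add: add_divide_distrib power_add)
  show ?thesis
    unfolding x y galois_map_fraction h[symmetric] by simp
qed

lemma galois_map_mult:
  assumes "x \<in> cyc_field \<theta>" "y \<in> cyc_field \<theta>"
  shows "galois_map \<zeta> (x * y) = galois_map \<zeta> x * galois_map \<zeta> y"
proof -
  let ?q = "of_nat CARD('p) :: 'p padic_closure"
  from assms obtain f n g m where x: "x = pev f \<kappa> / ?q ^ n" and y: "y = pev g \<kappa> / ?q ^ m"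
    by (metis cyc_field_cases)
  have h: "pev (f * g) z / ?q ^ (n + m) = pev f z / ?q ^ n * (pev g z / ?q ^ m)" for z
    unfolding pev_mult by (simp add: power_add)
  show ?thesis
    unfolding x y galois_map_fraction h[symmetric] by simp
qed

lemma galois_map_to_ac: "galois_map \<zeta> (to_ac r) = to_ac r"
proof -
  obtain s n where s: "to_ac r = of_padic_int s / of_nat CARD('p) ^ n" by (rule to_ac_padic_cases)
  thus ?thesis using galois_map_fraction[of "[:s:]" n] by simp
qed

lemma galois_map_of_padic: "galois_map \<zeta> (of_padic_int r) = of_padic_int r"
  by (simp add: of_padic_int_def galois_map_to_ac)

lemma galois_map_kappa: "galois_map \<zeta> \<kappa> = \<zeta> - 1"
  using galois_map_pev[of "[:0, 1:]"] by simp

lemma galois_map_theta: "galois_map \<zeta> \<theta> = \<zeta>"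
  using galois_map_pev[of "[:1, 1:]"] by (simp add: kappa_def)

lemma galois_map_pev_cyc: "x \<in> cyc_field \<theta> \<Longrightarrow> galois_map \<zeta> (pev f x) = pev f (galois_map \<zeta> x)"
proof (induction f)
  case 0
  show ?case using galois_map_of_padic[of 0] by simp
next
  case (pCons a f)
  have "pev f x \<in> cyc_field \<theta>" for f
    by (induction f) (use pCons.prems in auto)
  thus ?case using pCons by (simp add: galois_map_add galois_map_mult galois_map_of_padic)
qed

lemma galois_map_power: "x \<in> cyc_field \<theta> \<Longrightarrow> galois_map \<zeta> (x ^ n) = galois_map \<zeta> x ^ n"
  using galois_map_pev_cyc[of x "Polynomial.monom 1 n"] by (simp add: poly_monom)

lemma galois_map_cyc:
  assumes "\<zeta> \<in> cyc_field \<theta>" "x \<in> cyc_field \<theta>"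
  shows "galois_map \<zeta> x \<in> cyc_field \<theta>"
proof -
  obtain f n where x: "x = pev f \<kappa> / of_nat CARD('p) ^ n" using assms(2) by (rule cyc_field_cases)
  have "of_nat CARD('p) \<in> cyc_field \<theta>" by (rule R_cyc) simp
  moreover have "pev f (\<zeta> - 1) \<in> cyc_field \<theta>" by (induction f) (use assms in auto)
  ultimately show ?thesis unfolding x galois_map_fraction unfolding divide_inverse by blast
qed

lemma galois_map_inj:
  assumes "x \<in> cyc_field \<theta>" "y \<in> cyc_field \<theta>" "galois_map \<zeta> x = galois_map \<zeta> y"
  shows "x = y"
proof (rule ccontr)
  assume "x \<noteq> y"
  hence "1 = (x - y) * inverse (x - y)" by simp
  hence "galois_map \<zeta> 1 = galois_map \<zeta> (x - y) * galois_map \<zeta> (inverse (x - y))"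
    using assms by (metis galois_map_mult cyc_diff cyc_inverse)
  moreover have "galois_map \<zeta> x = galois_map \<zeta> (x - y) + galois_map \<zeta> y"
    using galois_map_add[of "x - y" y] assms by simp
  hence "galois_map \<zeta> (x - y) = 0" using assms(3) by simp
  moreover have "galois_map \<zeta> 1 = 1" using galois_map_of_padic[of 1] by simp
  ultimately show False by simp
qed

end

lemma theta_power: "\<theta> ^ CARD('p) = 1" and theta_nonzero: "\<theta> \<noteq> 0"
  using primitive prime_p(2) by (auto simp: primitive_root_of_unity_def power_0_left)

text \<open>Makes integer exponents, in particular the negative \<open>1 - a\<close>, natural, so
  that powers of \<open>\<theta>\<close> visibly lie in \<open>R\<close>.\<close>

lemma theta_powi: "\<theta> powi j = \<theta> ^ nat (j mod int CARD('p))"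
proof -
  have "\<theta> powi j = \<theta> powi (int CARD('p) * (j div int CARD('p)) + int (nat (j mod int CARD('p))))"
    using prime_p(2) by simp
  also have "\<dots> = \<theta> ^ nat (j mod int CARD('p))"
    unfolding power_int_add[OF disjI1[OF theta_nonzero]] power_int_mult power_int_of_nat
    by (simp add: theta_power)
  finally show ?thesis .
qed

lemma theta_powi_root:
  assumes "\<not> int CARD('p) dvd j"
  shows "(\<theta> powi j) ^ CARD('p) = 1" "\<theta> powi j \<noteq> 1" "\<theta> powi j \<in> R"
proof -
  have "(\<theta> powi j) ^ CARD('p) = (\<theta> ^ CARD('p)) ^ nat (j mod int CARD('p))"
    unfolding theta_powi by (simp only: mult.commute flip: power_mult)
  thus "(\<theta> powi j) ^ CARD('p) = 1" by (simp add: theta_power)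
  show "\<theta> powi j \<in> R" unfolding theta_powi by simp
  have "j mod int CARD('p) \<noteq> 0" "0 \<le> j mod int CARD('p)" "j mod int CARD('p) < int CARD('p)"
    using assms prime_p(2) by (auto simp: dvd_eq_mod_eq_0)
  hence "0 < nat (j mod int CARD('p))" "nat (j mod int CARD('p)) < CARD('p)" by linarith+
  thus "\<theta> powi j \<noteq> 1" unfolding theta_powi
    using primitive by (auto simp: primitive_root_of_unity_def)
qed

text \<open>Uniqueness holds because the values at \<open>\<theta>\<close> and on the p-adic numbers
  determine an automorphism; existence is \<open>galois_map\<close> at
  \<open>\<theta> powi j\<close>, with surjectivity shown by explicit preimages.\<close>

lemma gal_eq:
  assumes j: "\<not> int CARD('p) dvd j"
  shows "gal \<theta> j = restrict (galois_map (\<theta> powi j)) (cyc_field \<theta>)"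
  unfolding gal_def
proof (rule the_equality)
  let ?\<zeta> = "\<theta> powi j" and ?K = "cyc_field \<theta>"
  note root = theta_powi_root(1,2)[OF j]
  note zK = R_cyc[OF theta_powi_root(3)[OF j]]
  have "bij_betw (galois_map ?\<zeta>) ?K ?K"
    unfolding bij_betw_def
  proof
    show "inj_on (galois_map ?\<zeta>) ?K" using galois_map_inj[OF root] by (auto intro: inj_onI)
    have "?K \<subseteq> galois_map ?\<zeta> ` ?K"
    proof
      fix x assume "x \<in> ?K"
      then obtain f n where x: "x = pev f \<kappa> / of_nat CARD('p) ^ n" by (rule cyc_field_cases)
      from coprime_card_pow[OF j, of 1] obtain k where "[j * k = 1] (mod int CARD('p))"
        using cong_solve_coprime_int by auto
      hence "[j * (k mod int CARD('p)) = 1] (mod int CARD('p))" by (simp add: cong_def mod_simps)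
      hence k: "(j * int (nat (k mod int CARD('p)))) mod int CARD('p) = 1"
        using prime_p(2) by (simp add: cong_def)
      define m where "m = nat (k mod int CARD('p))"
      \<comment> \<open>As \<open>m\<close> inverts \<open>j\<close> modulo \<open>p\<close>,
        \<open>\<theta> ^ m\<close> is sent to \<open>\<theta>\<close>. Putting
        \<open>\<theta> ^ m - 1\<close> for \<open>\<kappa>\<close> in the numerator of
        \<open>x\<close> therefore gives a preimage.\<close>
      have "?\<zeta> ^ m = \<theta> powi (j * int m)" by (simp add: power_int_mult)
      also have "\<dots> = \<theta>" unfolding theta_powi m_def k by simp
      finally have m: "?\<zeta> ^ m = \<theta>" .
      define y where "y = pev f (\<theta> ^ m - 1) * to_ac (inverse (of_nat CARD('p) ^ n))"
      have t: "\<theta> ^ m - 1 \<in> R" by simp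
      hence yR: "pev f (\<theta> ^ m - 1) \<in> ?K" by (intro R_cyc R_pev_R)
      have "galois_map ?\<zeta> (\<theta> ^ m - 1) = ?\<zeta> ^ m - 1"
        using galois_map_add[OF root, of "\<theta> ^ m" "of_padic_int (- 1)"]
          galois_map_of_padic[OF root, of "- 1"]
        by (simp add: galois_map_power[OF root] galois_map_theta[OF root] of_padic.hom_uminus)
      hence "galois_map ?\<zeta> (\<theta> ^ m - 1) = \<kappa>" by (simp add: m kappa_def)
      hence "galois_map ?\<zeta> y = pev f \<kappa> * to_ac (inverse (of_nat CARD('p) ^ n))"
        unfolding y_def using yR t
        by (simp add: galois_map_mult[OF root] galois_map_pev_cyc[OF root] galois_map_to_ac[OF root]
            del: to_ac_inverse to_ac_power)
      also have "\<dots> = x" by (simp add: x divide_inverse)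
      finally show "x \<in> galois_map ?\<zeta> ` ?K" using yR by (auto simp: y_def simp del: to_ac_inverse to_ac_power)
    qed
    thus "galois_map ?\<zeta> ` ?K = ?K" using galois_map_cyc[OF root zK] by blast
  qed
  thus "restrict (galois_map ?\<zeta>) ?K \<in> extensional ?K \<and>
    bij_betw (restrict (galois_map ?\<zeta>) ?K) ?K ?K \<and>
    (\<forall>x\<in>?K. \<forall>y\<in>?K. restrict (galois_map ?\<zeta>) ?K (x + y) = restrict (galois_map ?\<zeta>) ?K x + restrict (galois_map ?\<zeta>) ?K y \<and>
      restrict (galois_map ?\<zeta>) ?K (x * y) = restrict (galois_map ?\<zeta>) ?K x * restrict (galois_map ?\<zeta>) ?K y) \<and>
    (\<forall>r. restrict (galois_map ?\<zeta>) ?K (to_ac r) = to_ac r) \<and> restrict (galois_map ?\<zeta>) ?K \<theta> = ?\<zeta>"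
    using galois_map_add[OF root] galois_map_mult[OF root] galois_map_to_ac[OF root] galois_map_theta[OF root]
    by (simp add: cyc_add cyc_mult)
next
  fix s :: "'p padic_closure \<Rightarrow> 'p padic_closure"
  let ?\<zeta> = "\<theta> powi j" and ?K = "cyc_field \<theta>"
  note root = theta_powi_root(1,2)[OF j]
  assume s: "s \<in> extensional ?K \<and> bij_betw s ?K ?K \<and>
    (\<forall>x\<in>?K. \<forall>y\<in>?K. s (x + y) = s x + s y \<and> s (x * y) = s x * s y) \<and>
    (\<forall>r. s (to_ac r) = to_ac r) \<and> s \<theta> = ?\<zeta>"
  have add: "s (x + y) = s x + s y" and mult: "s (x * y) = s x * s y" if "x \<in> ?K" "y \<in> ?K" for x y
    using s that by auto
  have r: "s (of_padic_int r) = of_padic_int r" for r using s by (simp add: of_padic_int_def)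
  have "s \<theta> = s \<kappa> + s (of_padic_int 1)" using add[of \<kappa> "of_padic_int 1"] by (simp add: kappa_def)
  hence k: "s \<kappa> = ?\<zeta> - 1" using s r[of 1] by simp
  have pK: "pev f \<kappa> \<in> ?K" for f by (rule R_cyc) simp
  have "s (pev f \<kappa>) = pev f (?\<zeta> - 1)" for f
  proof (induction f)
    case 0 thus ?case using r[of 0] by simp
  next
    case (pCons a f)
    thus ?case using pK[of f] by (simp add: add mult r k)
  qed
  hence sf: "s (pev f \<kappa> * to_ac t) = pev f (?\<zeta> - 1) * to_ac t" for f t
    using mult[OF pK, of "to_ac t" f] s by simp
  have "s x = galois_map ?\<zeta> x" if "x \<in> ?K" for x
  proof -
    from that obtain f n where x: "x = pev f \<kappa> / of_nat CARD('p) ^ n" by (rule cyc_field_cases)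
    show ?thesis using sf[of f "inverse (of_nat CARD('p) ^ n)"]
      unfolding x galois_map_fraction[OF root] by (simp add: divide_inverse)
  qed
  thus "s = restrict (galois_map ?\<zeta>) ?K"
    using s by (auto simp: extensional_def fun_eq_iff)
qed

lemma gal_cyc [simp, intro]:
  assumes "\<not> int CARD('p) dvd j" "x \<in> cyc_field \<theta>"
  shows "gal \<theta> j x \<in> cyc_field \<theta>"
  using assms theta_powi_root[OF assms(1)] by (simp add: gal_eq galois_map_cyc)

lemma gal_add:
  assumes "\<not> int CARD('p) dvd j" "x \<in> cyc_field \<theta>" "y \<in> cyc_field \<theta>"
  shows "gal \<theta> j (x + y) = gal \<theta> j x + gal \<theta> j y"
  using assms theta_powi_root[OF assms(1)] by (simp add: gal_eq galois_map_add)

lemma gal_mult: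
  assumes "\<not> int CARD('p) dvd j" "x \<in> cyc_field \<theta>" "y \<in> cyc_field \<theta>"
  shows "gal \<theta> j (x * y) = gal \<theta> j x * gal \<theta> j y"
  using assms theta_powi_root[OF assms(1)] by (simp add: gal_eq galois_map_mult)

lemma gal_of_padic:
  assumes "\<not> int CARD('p) dvd j"
  shows "gal \<theta> j (of_padic_int r) = of_padic_int r"
  using assms theta_powi_root[OF assms(1)] by (simp add: gal_eq galois_map_of_padic)

lemma gal_theta:
  assumes "\<not> int CARD('p) dvd j"
  shows "gal \<theta> j \<theta> = \<theta> powi j"
  using assms theta_powi_root[OF assms(1)] by (simp add: gal_eq galois_map_theta)

lemma gal_pev:
  assumes "\<not> int CARD('p) dvd j" "x \<in> R"
  shows "gal \<theta> j (pev f x) = pev f (gal \<theta> j x)"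
  using assms theta_powi_root[OF assms(1)] by (simp add: gal_eq galois_map_pev_cyc)

text \<open>The cofactor of \<open>\<kappa>\<close> is a sum of \<open>n\<close> powers of
  \<open>\<theta>\<close>, each congruent to 1 modulo \<open>P 1\<close>.\<close>

lemma lead_theta_power: "lead 1 (\<theta> ^ n - 1) (int n)"
proof -
  have "(\<Sum>i<n. \<theta> ^ i) - of_int (int n) = (\<Sum>i<n. \<theta> ^ i - 1)"
    by (simp add: sum_subtractf)
  also have "\<dots> \<in> P 1"
  proof (rule P_sum)
    fix i
    have "\<theta> ^ i - 1 = \<kappa> * (\<Sum>k<i. \<theta> ^ k)" by (simp add: power_diff_1_eq kappa_def)
    also have "\<dots> \<in> P 1" using P_kappa[of 1] by (intro P_mult_R' R_sum) auto
    finally show "\<theta> ^ i - 1 \<in> P 1" .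
  qed
  finally have "lead 0 (\<Sum>i<n. \<theta> ^ i) (int n)" by (simp add: lead_def)
  from lead_mult[OF lead_kappa[of 1] this] show ?thesis
    by (simp add: power_diff_1_eq kappa_def)
qed

lemma gal_gal_like:
  assumes "\<not> int CARD('p) dvd j"
  shows "gal_like (gal \<theta> j) j"
  unfolding gal_like_def
proof (intro conjI ballI allI)
  note root = theta_powi_root[OF assms]
  fix x y assume xy: "x \<in> R" "y \<in> R"
  show "gal \<theta> j (x + y) = gal \<theta> j x + gal \<theta> j y" "gal \<theta> j (x * y) = gal \<theta> j x * gal \<theta> j y"
    using xy by (simp_all add: gal_add[OF assms] gal_mult[OF assms] R_cyc)
next
  fix x assume "x \<in> R"
  then obtain f where f: "x = pev f \<kappa>" by (auto simp: R_def)
  show "gal \<theta> j x \<in> R" using theta_powi_root[OF assms] \<open>x \<in> R\<close>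
    by (simp add: gal_eq[OF assms] f galois_map_pev)
next
  show "gal \<theta> j (of_padic_int r) = of_padic_int r" for r by (rule gal_of_padic[OF assms])
next
  define n where "n = nat (j mod int CARD('p))"
  have k: "gal \<theta> j \<kappa> = \<theta> ^ n - 1"
    using theta_powi_root[OF assms] by (simp add: gal_eq[OF assms] galois_map_kappa theta_powi n_def)
  \<comment> \<open>The computation yields the reduced exponent \<open>n\<close>;
    \<open>lead\<close> ignores multiples of \<open>p\<close>, so \<open>j\<close> itself may take
    its place.\<close>
  have "int CARD('p) dvd int n - j"
    using prime_p(2) by (simp add: n_def mod_eq_dvd_iff[symmetric])
  hence "of_int (int n - j) * \<kappa> ^ 1 \<in> P (1 + 1)"
    by (intro P_mult) (simp_all only: of_int_P1_iff P_kappa)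
  hence "(\<theta> ^ n - 1 - of_int (int n) * \<kappa> ^ 1) + of_int (int n - j) * \<kappa> ^ 1 \<in> P (Suc 1)"
    using lead_theta_power[of n] by (intro P_add) (auto simp: lead_def)
  thus "lead 1 (gal \<theta> j \<kappa>) j" by (simp add: lead_def k algebra_simps)
qed

lemma gal_commute:
  assumes "\<not> int CARD('p) dvd j" "\<not> int CARD('p) dvd k" "x \<in> R"
  shows "gal \<theta> j (gal \<theta> k x) = gal \<theta> k (gal \<theta> j x)"
proof -
  obtain f where f: "x = pev f \<theta>"
  proof -
    obtain g where "x = pev g \<kappa>" using assms(3) by (auto simp: R_def)
    \<comment> \<open>Composition with \<open>X - 1\<close> turns an expression in
      \<open>\<kappa>\<close> into one in \<open>\<theta>\<close>, where automorphisms just multiply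
      exponents.\<close>
    moreover have "pev (g \<circ>\<^sub>p [:-1, 1:]) \<theta> = pev g \<kappa>"
      by (induction g) (auto simp: pcompose_pCons kappa_def of_padic.hom_uminus pev_diff algebra_simps)
    ultimately show ?thesis using that by metis
  qed
  have R: "\<theta> powi j \<in> R" "\<theta> powi k \<in> R" using theta_powi_root assms by auto
  have pw: "gal \<theta> i (\<theta> powi l) = (\<theta> powi i) powi l" if "\<not> int CARD('p) dvd i" for i l
  proof -
    define n where "n = nat (l mod int CARD('p))"
    have "gal \<theta> i (\<theta> ^ n) = gal \<theta> i \<theta> ^ n"
      by (rule gal_like_power[OF gal_gal_like[OF that]]) simp
    also have "\<dots> = (\<theta> powi i) ^ n" by (simp add: gal_theta[OF that])
    also have "\<dots> = (\<theta> ^ n) powi i" by (simp add: power_int_power power_int_power' mult.commute)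
    also have "\<dots> = (\<theta> powi l) powi i" by (simp add: theta_powi n_def)
    also have "\<dots> = (\<theta> powi i) powi l" by (metis mult.commute power_int_mult)
    finally show ?thesis by (simp only: theta_powi[of l] n_def)
  qed
  have "gal \<theta> j (gal \<theta> k x) = pev f ((\<theta> powi j) powi k)"
    using R by (simp add: f gal_pev assms gal_theta pw)
  also have "(\<theta> powi j) powi k = (\<theta> powi k) powi j" by (simp add: mult.commute flip: power_int_mult)
  also have "pev f \<dots> = gal \<theta> k (gal \<theta> j x)"
    using R by (simp add: f gal_pev assms gal_theta pw)
  finally show ?thesis .
qed

end

section \<open>Maps out of exterior squares\<close>

definition extend_linear ::
  "('p :: prime_card padic_closure \<Rightarrow> 'p padic_closure \<Rightarrow> 'p padic_closure) \<Rightarrow> 'p tensors \<Rightarrow> 'p padic_closure" where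
  "extend_linear B f = (\<Sum>(x, y)\<in>Poly_Mapping.keys f. of_padic_int (Poly_Mapping.lookup f (x, y)) * B x y)"

lemma extend_linear_superset:
  assumes "finite S" "Poly_Mapping.keys f \<subseteq> S"
  shows "extend_linear B f = (\<Sum>(x, y)\<in>S. of_padic_int (Poly_Mapping.lookup f (x, y)) * B x y)"
  unfolding extend_linear_def using assms
  by (intro sum.mono_neutral_left) (auto simp: in_keys_iff)

lemma extend_linear_add: "extend_linear B (f + g) = extend_linear B f + extend_linear B g"
proof -
  let ?S = "Poly_Mapping.keys f \<union> Poly_Mapping.keys g"
  show ?thesis
    using keys_add[of f g]
    by (simp add: extend_linear_superset[of ?S] lookup_add of_padic.hom_add distrib_right
        case_prod_unfold sum.distrib)
qed

lemma extend_linear_scale: "extend_linear B (scale r f) = of_padic_int r * extend_linear B f"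
proof -
  have "Poly_Mapping.keys (scale r f) \<subseteq> Poly_Mapping.keys f" by (auto simp: in_keys_iff)
  thus ?thesis
    by (simp add: extend_linear_superset[of "Poly_Mapping.keys f"] of_padic.hom_mult
        case_prod_unfold sum_distrib_left mult.assoc)
qed

lemma extend_linear_single [simp]:
  "extend_linear B (Poly_Mapping.single (x, y) r) = of_padic_int r * B x y"
  by (subst extend_linear_superset[of "{(x, y)}"]) auto

lemma extend_linear_zero [simp]: "extend_linear B 0 = 0"
  by (simp add: extend_linear_def)

lemma scale_minus_one: "f - g = f + scale (- 1) g" for f g :: "'b \<Rightarrow>\<^sub>0 'p :: prime_card padic_int"
  by (rule poly_mapping_eqI) (simp add: lookup_add lookup_minus)

lemma extend_linear_diff: "extend_linear B (f - g) = extend_linear B f - extend_linear B g"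
  unfolding scale_minus_one extend_linear_add extend_linear_scale of_padic.hom_uminus by simp

definition alternating_bilinear ::
  "'p :: prime_card padic_closure set \<Rightarrow> ('p padic_closure \<Rightarrow> 'p padic_closure \<Rightarrow> 'p padic_closure) \<Rightarrow> bool" where
  "alternating_bilinear M B \<longleftrightarrow>
     (\<forall>x\<in>M. \<forall>x'\<in>M. \<forall>y\<in>M. B (x + x') y = B x y + B x' y) \<and>
     (\<forall>x\<in>M. \<forall>y\<in>M. \<forall>y'\<in>M. B x (y + y') = B x y + B x y') \<and>
     (\<forall>r. \<forall>x\<in>M. \<forall>y\<in>M. B (of_padic_int r * x) y = of_padic_int r * B x y) \<and>
     (\<forall>r. \<forall>x\<in>M. \<forall>y\<in>M. B x (of_padic_int r * y) = of_padic_int r * B x y) \<and>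
     (\<forall>x\<in>M. B x x = 0)"

lemma extend_linear_relations:
  assumes "alternating_bilinear M B" "g \<in> ext_relations M"
  shows "extend_linear B g = 0"
  using assms(2) unfolding ext_relations_def
proof (induction rule: free.span_induct)
  case base
  show ?case
    by (auto simp: free.subspace_def extend_linear_add extend_linear_scale)
next
  case (step f)
  thus ?case using assms(1)
    by (auto simp: alternating_bilinear_def extend_linear_diff extend_linear_scale)
qed

section \<open>Cosets of the relations, and the universal property\<close>

lemma ext_relations_closed:
  "0 \<in> ext_relations M" "f \<in> ext_relations M \<Longrightarrow> g \<in> ext_relations M \<Longrightarrow> f + g \<in> ext_relations M"
  "f \<in> ext_relations M \<Longrightarrow> scale r f \<in> ext_relations M"
  unfolding ext_relations_def by (rule free.span_zero free.span_add free.span_scale; assumption)+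

lemma ext_relations_mono: "M \<subseteq> N \<Longrightarrow> ext_relations M \<subseteq> ext_relations N"
  unfolding ext_relations_def by (rule free.span_mono) blast

lemma ext_class_self: "f \<in> ext_class M f"
  unfolding ext_class_def using ext_relations_closed(1) by force

lemma ext_class_add: "ext_add (ext_class M f) (ext_class M g) = ext_class M (f + g)"
proof
  show "ext_add (ext_class M f) (ext_class M g) \<subseteq> ext_class M (f + g)"
    unfolding ext_add_def ext_class_def
    using ext_relations_closed(2) by (force simp: algebra_simps)
  show "ext_class M (f + g) \<subseteq> ext_add (ext_class M f) (ext_class M g)"
  proof
    fix h assume "h \<in> ext_class M (f + g)"
    then obtain r where r: "r \<in> ext_relations M" "h = f + (g + r)" by (auto simp: ext_class_def add.assoc)
    hence "g + r \<in> ext_class M g" by (auto simp: ext_class_def)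
    thus "h \<in> ext_add (ext_class M f) (ext_class M g)"
      using ext_class_self[of f M] r(2) unfolding ext_add_def by blast
  qed
qed

text \<open>\<open>ext_scale\<close> and \<open>ext_inclusion\<close> are both unions of this form,
  for an additive \<open>\<phi>\<close> respecting relations; one argument shows that each yields a
  single coset.\<close>

lemma ext_class_UN:
  assumes "M \<subseteq> N" "\<And>g. g \<in> ext_relations M \<Longrightarrow> \<phi> g \<in> ext_relations N"
    "\<And>f g. \<phi> (f + g) = \<phi> f + \<phi> g"
  shows "(\<Union>h\<in>ext_class M f. ext_class N (\<phi> h)) = ext_class N (\<phi> f)"
proof
  show "(\<Union>h\<in>ext_class M f. ext_class N (\<phi> h)) \<subseteq> ext_class N (\<phi> f)"
  proof safe
    fix h k assume "h \<in> ext_class M f" "k \<in> ext_class N (\<phi> h)"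
    then obtain r s where "r \<in> ext_relations M" "s \<in> ext_relations N" "k = \<phi> f + (\<phi> r + s)"
      by (auto simp: ext_class_def assms(3) add.assoc)
    thus "k \<in> ext_class N (\<phi> f)" using assms(2) ext_relations_closed(2) by (auto simp: ext_class_def)
  qed
  show "ext_class N (\<phi> f) \<subseteq> (\<Union>h\<in>ext_class M f. ext_class N (\<phi> h))"
    using ext_class_self[of f M] by blast
qed

lemma ext_class_scale: "ext_scale M r (ext_class M f) = ext_class M (scale r f)"
  unfolding ext_scale_def
  by (rule ext_class_UN) (auto simp: ext_relations_closed(3) free.scale_right_distrib)

lemma ext_class_inclusion: "M \<subseteq> N \<Longrightarrow> ext_inclusion N (ext_class M f) = ext_class N f"
  unfolding ext_inclusion_def
  by (rule ext_class_UN[of M N "\<lambda>f. f"]) (use ext_relations_mono in auto)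

text \<open>Any representative serves: two of them differ by a relation, which an alternating
  bilinear \<open>B\<close> sends to 0 (\<open>induced_map_class\<close>).\<close>

definition induced_map ::
  "('p :: prime_card padic_closure \<Rightarrow> 'p padic_closure \<Rightarrow> 'p padic_closure) \<Rightarrow> 'p tensors set \<Rightarrow> 'p padic_closure" where
  "induced_map B A = extend_linear B (SOME f. f \<in> A)"

lemma induced_map_class:
  assumes "alternating_bilinear M B"
  shows "induced_map B (ext_class M f) = extend_linear B f"
proof -
  have "(SOME g. g \<in> ext_class M f) \<in> ext_class M f"
    using ext_class_self[of f M] by (rule someI)
  then obtain g where "g \<in> ext_relations M" "(SOME g. g \<in> ext_class M f) = f + g"
    by (auto simp: ext_class_def)
  thus ?thesis
    by (simp add: induced_map_def extend_linear_add extend_linear_relations[OF assms])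
qed

lemma ext_squareE:
  assumes "A \<in> ext_square M"
  obtains f where "A = ext_class M f" "Poly_Mapping.keys f \<subseteq> M \<times> M"
  using assms by (auto simp: ext_square_def)

lemma ext_squareI: "Poly_Mapping.keys f \<subseteq> M \<times> M \<Longrightarrow> ext_class M f \<in> ext_square M"
  by (auto simp: ext_square_def)

lemma wedge_in_ext_square: "x \<in> M \<Longrightarrow> y \<in> M \<Longrightarrow> wedge M x y \<in> ext_square M"
  unfolding wedge_def by (rule ext_squareI) simp

lemma keys_scale: "Poly_Mapping.keys (scale r f) \<subseteq> Poly_Mapping.keys f"
  by (auto simp: in_keys_iff)

lemma extend_linear_in:
  assumes "\<And>x y. x \<in> M \<Longrightarrow> y \<in> M \<Longrightarrow> B x y \<in> N" "0 \<in> N"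
    "\<And>x y. x \<in> N \<Longrightarrow> y \<in> N \<Longrightarrow> x + y \<in> N" "\<And>r x. x \<in> N \<Longrightarrow> of_padic_int r * x \<in> N"
    "Poly_Mapping.keys f \<subseteq> M \<times> M"
  shows "extend_linear B f \<in> N"
proof -
  have "(\<Sum>(x, y)\<in>S. of_padic_int (Poly_Mapping.lookup f (x, y)) * B x y) \<in> N"
    if "S \<subseteq> M \<times> M" for S
    using that by (induction S rule: infinite_finite_induct) (use assms(1-4) in auto)
  thus ?thesis using assms(5) unfolding extend_linear_def by blast
qed

lemma induced_map_ext_hom:
  assumes "alternating_bilinear M B" "\<And>x y. x \<in> M \<Longrightarrow> y \<in> M \<Longrightarrow> B x y \<in> N" "0 \<in> N"
    "\<And>x y. x \<in> N \<Longrightarrow> y \<in> N \<Longrightarrow> x + y \<in> N" "\<And>r x. x \<in> N \<Longrightarrow> of_padic_int r * x \<in> N"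
  shows "restrict (induced_map B) (ext_square M) \<in> ext_hom M N"
  unfolding ext_hom_def mem_Collect_eq
proof (intro conjI ballI allI)
  note [simp] = induced_map_class[OF assms(1)]
  have "induced_map B A \<in> N" if "A \<in> ext_square M" for A
    using that by (rule ext_squareE) (simp add: extend_linear_in[OF assms(2-5)])
  thus "restrict (induced_map B) (ext_square M) \<in> ext_square M \<rightarrow>\<^sub>E N" by auto
next
  note [simp] = induced_map_class[OF assms(1)]
  fix A assume "A \<in> ext_square M"
  then obtain f where f: "A = ext_class M f" "Poly_Mapping.keys f \<subseteq> M \<times> M" by (rule ext_squareE)
  {
    fix C assume "C \<in> ext_square M"
    then obtain g where g: "C = ext_class M g" "Poly_Mapping.keys g \<subseteq> M \<times> M" by (rule ext_squareE)
    have "ext_class M (f + g) \<in> ext_square M"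
      using f g keys_add[of f g] by (intro ext_squareI) blast
    thus "restrict (induced_map B) (ext_square M) (ext_add A C) =
       restrict (induced_map B) (ext_square M) A + restrict (induced_map B) (ext_square M) C"
      using f g by (simp add: ext_class_add ext_squareI extend_linear_add)
  }
  fix r
  have "ext_class M (scale r f) \<in> ext_square M"
    using f keys_scale[of r f] by (intro ext_squareI) blast
  thus "restrict (induced_map B) (ext_square M) (ext_scale M r A) =
      of_padic_int r * restrict (induced_map B) (ext_square M) A"
    using f by (simp add: ext_class_scale ext_squareI extend_linear_scale)
qed

lemma ext_hom_class:
  assumes "t \<in> ext_hom M N" "Poly_Mapping.keys f \<subseteq> M \<times> M"
  shows "t (ext_class M f) = extend_linear (\<lambda>x y. t (wedge M x y)) f"
  using assms(2)
proof (induction f rule: update_induct)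
  case const
  \<comment> \<open>The value at the zero class comes from homogeneity with scalar 0.\<close>
  have "ext_scale M 0 (ext_class M 0) = ext_class M 0" by (simp add: ext_class_scale)
  moreover have "ext_class M 0 \<in> ext_square M" by (rule ext_squareI) simp
  ultimately have "t (ext_class M 0) = of_padic_int 0 * t (ext_class M 0)"
    using assms(1) by (metis (mono_tags, lifting) ext_hom_def mem_Collect_eq)
  thus ?case by simp
next
  case (update f a b)
  obtain x y where a: "a = (x, y)" by (cases a)
  have "Poly_Mapping.keys (Poly_Mapping.update a b f) = insert a (Poly_Mapping.keys f)"
    using update by (simp add: keys_update)
  with update.prems have M: "x \<in> M" "y \<in> M" "Poly_Mapping.keys f \<subseteq> M \<times> M" by (auto simp: a)
  have u: "Poly_Mapping.update a b f = f + scale b (gen x y)"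
    using update(1) by (intro poly_mapping_eqI)
      (auto simp: lookup_update lookup_add a lookup_single in_keys_iff when_def)
  have sq: "ext_class M (gen x y) \<in> ext_square M" "ext_class M f \<in> ext_square M"
    "ext_class M (scale b (gen x y)) \<in> ext_square M"
    using M keys_scale[of b "gen x y"] by (auto intro!: ext_squareI)
  have "t (ext_class M (f + scale b (gen x y))) =
      t (ext_class M f) + t (ext_scale M b (ext_class M (gen x y)))"
    using assms(1) sq by (simp add: ext_hom_def ext_class_scale flip: ext_class_add)
  also have "t (ext_scale M b (ext_class M (gen x y))) = of_padic_int b * t (ext_class M (gen x y))"
    using assms(1) sq by (simp add: ext_hom_def)
  finally show ?case
    using update.IH M by (simp add: u extend_linear_add extend_linear_scale wedge_def)
qed

text \<open>Wedges generate the exterior square, and outside it extensionality fixes the value. This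
  settles uniqueness in the definite description of \<open>vartheta\<close>.\<close>

lemma ext_hom_unique:
  assumes "t \<in> ext_hom M N" "s \<in> ext_hom M N"
    "\<And>x y. x \<in> M \<Longrightarrow> y \<in> M \<Longrightarrow> t (wedge M x y) = s (wedge M x y)"
  shows "t = s"
proof
  fix A
  show "t A = s A"
  proof (cases "A \<in> ext_square M")
    case True
    then obtain f where f: "A = ext_class M f" "Poly_Mapping.keys f \<subseteq> M \<times> M" by (rule ext_squareE)
    have "extend_linear (\<lambda>x y. t (wedge M x y)) f = extend_linear (\<lambda>x y. s (wedge M x y)) f"
      unfolding extend_linear_def using f(2) assms(3) by (intro sum.cong) auto
    thus ?thesis using f ext_hom_class[OF assms(1)] ext_hom_class[OF assms(2)] by simp
  next
    case False
    thus ?thesis using assms(1,2) by (auto simp: ext_hom_def PiE_def extensional_def)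
  qed
qed

lemma induced_map_wedge: "alternating_bilinear M B \<Longrightarrow> induced_map B (wedge M x y) = B x y"
  by (simp add: wedge_def induced_map_class)

lemma extend_linear_mult: "extend_linear (\<lambda>x y. c * B x y) f = c * extend_linear B f"
  by (simp add: extend_linear_def sum_distrib_left case_prod_unfold mult.left_commute)

section \<open>Determinants and leading coefficients\<close>

definition det3 :: "'a :: idom \<Rightarrow> 'a \<Rightarrow> 'a \<Rightarrow> 'a \<Rightarrow> 'a \<Rightarrow> 'a \<Rightarrow> 'a \<Rightarrow> 'a \<Rightarrow> 'a \<Rightarrow> 'a" where
  "det3 x1 x2 x3 y1 y2 y3 z1 z2 z3 =
     x1 * (y2 * z3 - y3 * z2) - x2 * (y1 * z3 - y3 * z1) + x3 * (y1 * z2 - y2 * z1)"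

text \<open>Multiplicativity of the determinant with the product matrix written out. It will
  separate the digits of three elements from the values at powers of
  \<open>\<kappa>\<close>.\<close>

lemma det3_mult:
  "det3 (u0 * x1 + u1 * y1 + u2 * z1) (u0 * x2 + u1 * y2 + u2 * z2) (u0 * x3 + u1 * y3 + u2 * z3)
        (v0 * x1 + v1 * y1 + v2 * z1) (v0 * x2 + v1 * y2 + v2 * z2) (v0 * x3 + v1 * y3 + v2 * z3)
        (w0 * x1 + w1 * y1 + w2 * z1) (w0 * x2 + w1 * y2 + w2 * z2) (w0 * x3 + w1 * y3 + w2 * z3)
   = det3 u0 u1 u2 v0 v1 v2 w0 w1 w2 * det3 x1 x2 x3 y1 y2 y3 z1 z2 z3"
  unfolding det3_def by Groebner_Basis.algebra

text \<open>Leading coefficient of the Jacobi expression at \<open>\<kappa> ^ l\<close>,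
  \<open>\<kappa> ^ m\<close>, \<open>\<kappa> ^ n\<close>, up to the contribution of
  \<open>c\<close>. Rows belong to the arguments, columns to the composite automorphisms.\<close>

definition jacobi_lead :: "int \<Rightarrow> nat \<Rightarrow> nat \<Rightarrow> nat \<Rightarrow> int" where
  "jacobi_lead a l m n = (let b = 1 - a in
     det3 ((a * a) ^ l) ((a * b) ^ l) (b ^ l) ((a * a) ^ m) ((a * b) ^ m) (b ^ m) ((a * a) ^ n) ((a * b) ^ n) (b ^ n) +
     det3 ((b * b) ^ l) ((a * b) ^ l) (a ^ l) ((b * b) ^ m) ((a * b) ^ m) (a ^ m) ((b * b) ^ n) ((a * b) ^ n) (a ^ n))"

text \<open>Beside the monomial and the Vandermonde product stands a Schur polynomial: 1 for
  consecutive exponents, the second elementary symmetric function for the gap after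
  \<open>i\<close>.\<close>

lemma det3_vandermonde:
  fixes x y z :: "'a :: idom"
  shows "det3 (x ^ i) (y ^ i) (z ^ i) (x ^ (i + 1)) (y ^ (i + 1)) (z ^ (i + 1)) (x ^ (i + 2)) (y ^ (i + 2)) (z ^ (i + 2)) =
      x ^ i * y ^ i * z ^ i * ((y - x) * (z - x) * (z - y))"
    and "det3 (x ^ i) (y ^ i) (z ^ i) (x ^ (i + 2)) (y ^ (i + 2)) (z ^ (i + 2)) (x ^ (i + 3)) (y ^ (i + 3)) (z ^ (i + 3)) =
      x ^ i * y ^ i * z ^ i * ((y - x) * (z - x) * (z - y)) * (x * y + y * z + z * x)"
  unfolding det3_def power_add by (Groebner_Basis.algebra, Groebner_Basis.algebra)

text \<open>
  Write the two leading coefficients as \<open>A + B\<close> and \<open>A e + B e'\<close>, with \<open>e\<close>, \<open>e'\<close> the second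
  elementary symmetric functions of the two triples of exponents. If both vanish modulo \<open>q\<close>, then
  so do \<open>A\<close> and \<open>B\<close>, which forces \<open>a\<^sup>2 = b\<close> and \<open>b\<^sup>2 = a\<close> modulo \<open>q\<close>.
\<close>

lemma jacobi_lead_nonzero:
  fixes q a :: int
  assumes q: "prime q" "\<not> q dvd 2" "\<not> q dvd a" "\<not> q dvd 1 - a" "\<not> q dvd 2 * a - 1"
    and dvd: "q dvd jacobi_lead a i (i + 1) (i + 2)" "q dvd jacobi_lead a i (i + 2) (i + 3)"
  shows False
proof -
  define b where "b = 1 - a"
  define A where "A = (a * a) ^ i * (a * b) ^ i * b ^ i * ((a * b - a * a) * (b - a * a) * (b - a * b))"
  define B where "B = (b * b) ^ i * (a * b) ^ i * a ^ i * ((a * b - b * b) * (a - b * b) * (a - a * b))"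
  define e where "e = (a * a) * (a * b) + (a * b) * b + b * (a * a)"
  define e' where "e' = (b * b) * (a * b) + (a * b) * a + a * (b * b)"
  have 1: "q dvd A + B" and 2: "q dvd A * e + B * e'"
    using dvd by (simp_all only: jacobi_lead_def Let_def det3_vandermonde A_def B_def b_def e_def e'_def)
  have nd: "\<not> q dvd a" "\<not> q dvd b" "\<not> q dvd a - b" using q by (auto simp: b_def algebra_simps)
  \<comment> \<open>The two are \<open>a * b\<close> times \<open>a * a + a + b\<close> and
    \<open>b * b + a + b\<close>; with \<open>a + b = 1\<close> the difference is a product prime to
    \<open>q\<close>. Subtracting \<open>e'\<close> times the first coefficient from the second thus
    isolates \<open>A\<close>.\<close>
  have e: "e - e' = a * b * (a - b)" unfolding e_def e'_def b_def by Groebner_Basis.algebra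
  have "A * (a * b * (a - b)) = (A * e + B * e') - e' * (A + B)" unfolding e[symmetric] by Groebner_Basis.algebra
  hence "q dvd A * (a * b * (a - b))" using 1 2 by (simp add: dvd_diff dvd_mult)
  hence A: "q dvd A" using nd q(1) by (simp add: prime_dvd_mult_iff)
  hence B: "q dvd B" using 1 by (simp add: dvd_add_right_iff)
  \<comment> \<open>By \<open>a + b = 1\<close>, \<open>b - a * b\<close> is \<open>b * b\<close>
    and \<open>a - a * b\<close> is \<open>a * a\<close>, which leaves in each product a single
    factor that \<open>q\<close> may divide.\<close>
  have "A = (a * a) ^ i * (a * b) ^ i * b ^ i * (a * (a - b) * (b * b) * (a * a - b))"
    "B = (b * b) ^ i * (a * b) ^ i * a ^ i * (b * (a - b) * (a * a) * (a - b * b))"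
    unfolding A_def B_def b_def by Groebner_Basis.algebra+
  moreover have "\<not> q dvd (a * a) ^ i" "\<not> q dvd (a * b) ^ i" "\<not> q dvd (b * b) ^ i" "\<not> q dvd a ^ i" "\<not> q dvd b ^ i"
    using nd q(1) prime_dvd_power[OF q(1)] by (meson prime_dvd_mult_iff)+
  ultimately have "q dvd a * a - b" "q dvd a - b * b"
    using A B nd q(1) by (simp_all add: prime_dvd_mult_iff)
  hence "q dvd (a * a - b) + (a - b * b)" by (rule dvd_add)
  also have "(a * a - b) + (a - b * b) = 2 * (a - b)" unfolding b_def by Groebner_Basis.algebra
  finally show False using nd q(2) prime_dvd_multD[OF q(1)] by blast
qed

text \<open>For \<open>a = 2\<close>, \<open>b = - 1\<close> the bases \<open>a * a = 4\<close> and
  \<open>b\<close> agree modulo 5, so the first determinant vanishes there; the second has bases 1,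
  -2, 2, which are distinct modulo 5.\<close>

lemma jacobi_lead_five: "\<not> 5 dvd jacobi_lead 2 i (i + 1) (i + 2)"
proof
  assume "5 dvd jacobi_lead 2 i (i + 1) (i + 2)"
  hence "5 dvd (2 * 2 :: int) ^ i * (2 * (1 - 2)) ^ i * (1 - 2) ^ i *
        ((2 * (1 - 2) - 2 * 2) * (1 - 2 - 2 * 2) * (1 - 2 - 2 * (1 - 2))) +
      ((1 - 2) * (1 - 2)) ^ i * (2 * (1 - 2)) ^ i * 2 ^ i *
        ((2 * (1 - 2) - (1 - 2) * (1 - 2)) * (2 - (1 - 2) * (1 - 2)) * (2 - 2 * (1 - 2)))"
    by (simp only: jacobi_lead_def Let_def det3_vandermonde)
  also have "\<dots> = 5 * (4 ^ i * (- 2) ^ i * (- 1) ^ i * 6) + (- 2) ^ i * 2 ^ i * (- 12)"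
    by simp
  finally have "5 dvd (- 2 :: int) ^ i * 2 ^ i * (- 12)"
    by (subst (asm) dvd_add_right_iff) auto
  moreover have p5: "prime (5 :: int)" by simp
  ultimately have "5 dvd (- 2 :: int) ^ i \<or> 5 dvd (2 :: int) ^ i \<or> 5 dvd (- 12 :: int)"
    by (simp add: prime_dvd_mult_iff)
  hence "5 dvd (- 2 :: int) \<or> 5 dvd (2 :: int) \<or> 5 dvd (- 12 :: int)"
    using prime_dvd_power[OF p5] by blast
  thus False by simp
qed

context cyclotomic
begin

lemma lead_det3:
  assumes "lead l x1 a1" "lead l x2 a2" "lead l x3 a3" "lead m y1 b1" "lead m y2 b2" "lead m y3 b3"
    "lead n z1 c1" "lead n z2 c2" "lead n z3 c3"
  shows "lead (l + m + n) (det3 x1 x2 x3 y1 y2 y3 z1 z2 z3) (det3 a1 a2 a3 b1 b2 b3 c1 c2 c3)"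
  unfolding det3_def add.assoc
  by (intro lead_add lead_diff lead_mult assms)

lemma lead_gal_like_kappa: "gal_like f j \<Longrightarrow> lead n (f (\<kappa> ^ n)) (j ^ n)"
  using lead_gal_like[OF _ lead_kappa] by fastforce

lemma ex_three_leads:
  assumes "x \<in> P i"
  obtains a b c y where "x = of_int a * \<kappa> ^ i + of_int b * \<kappa> ^ (i + 1) + of_int c * \<kappa> ^ (i + 2) + y" "y \<in> P (i + 3)"
proof -
  obtain a where a: "lead i x a" using assms by (rule ex_lead)
  hence "x - of_int a * \<kappa> ^ i \<in> P (Suc i)" by (simp only: lead_def)
  then obtain b where "lead (Suc i) (x - of_int a * \<kappa> ^ i) b" by (rule ex_lead)
  hence "x - of_int a * \<kappa> ^ i - of_int b * \<kappa> ^ Suc i \<in> P (Suc (Suc i))" by (simp only: lead_def)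
  then obtain c where c: "lead (Suc (Suc i)) (x - of_int a * \<kappa> ^ i - of_int b * \<kappa> ^ Suc i) c"
    by (rule ex_lead)
  show ?thesis
    by (rule that[of a b c "x - of_int a * \<kappa> ^ i - of_int b * \<kappa> ^ Suc i - of_int c * \<kappa> ^ Suc (Suc i)"])
      (use c in \<open>simp_all add: lead_def eval_nat_numeral\<close>)
qed

text \<open>
  Modulo \<open>P (3 * i + 3)\<close> the alternating form only sees the first three digits of its arguments,
  on which it is a multiple of its value at \<open>\<kappa>\<^sup>i\<close>, \<open>\<kappa>\<^sup>i\<^sup>+\<^sup>1\<close>, \<open>\<kappa>\<^sup>i\<^sup>+\<^sup>2\<close>.
\<close>

lemma det3_gal_like_in_P:
  assumes f: "gal_like f1 j1" "gal_like f2 j2" "gal_like f3 j3"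
    and u: "u \<in> P i" "v \<in> P i" "w \<in> P i"
  shows "det3 (f1 u) (f2 u) (f3 u) (f1 v) (f2 v) (f3 v) (f1 w) (f2 w) (f3 w) \<in> P (3 * i + 3)"
proof -
  define T where "T u v w = det3 (f1 u) (f2 u) (f3 u) (f1 v) (f2 v) (f3 v) (f1 w) (f2 w) (f3 w)" for u v w
  have P: "T u v w \<in> P (l + m + n)" if "u \<in> P l" "v \<in> P m" "w \<in> P n" for u v w l m n
    unfolding T_def det3_def add.assoc
    by (intro P_add P_diff P_mult gal_like_P[OF f(1)] gal_like_P[OF f(2)] gal_like_P[OF f(3)] that)
  define S where "S a b c = of_int a * \<kappa> ^ i + of_int b * \<kappa> ^ (i + 1) + of_int c * \<kappa> ^ (i + 2)" for a b c
  have SR: "S a b c \<in> R" for a b c by (auto simp: S_def simp del: power_Suc add_Suc_right)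
  have SP: "S a b c \<in> P i" for a b c
    using P_mono[of i "i + 1"] P_mono[of i "i + 2"] P_kappa[of "i + 1"] P_kappa[of "i + 2"]
    unfolding S_def by (intro P_add P_mult_R) auto
  obtain u0 u1 u2 u' where u': "u = S u0 u1 u2 + u'" "u' \<in> P (i + 3)"
    using ex_three_leads[OF u(1)] unfolding S_def by metis
  obtain v0 v1 v2 v' where v': "v = S v0 v1 v2 + v'" "v' \<in> P (i + 3)"
    using ex_three_leads[OF u(2)] unfolding S_def by metis
  obtain w0 w1 w2 w' where w': "w = S w0 w1 w2 + w'" "w' \<in> P (i + 3)"
    using ex_three_leads[OF u(3)] unfolding S_def by metis
  note R = P_R[OF u'(2)] P_R[OF v'(2)] P_R[OF w'(2)]
  note add = gal_likeD(2)[OF f(1) SR] gal_likeD(2)[OF f(2) SR] gal_likeD(2)[OF f(3) SR]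
  \<comment> \<open>The arguments are truncated one at a time; each error term has one argument in
    \<open>P (i + 3)\<close> and two in \<open>P i\<close>.\<close>
  have "T u v w = T u' v w + T (S u0 u1 u2) v' w + T (S u0 u1 u2) (S v0 v1 v2) w' +
      T (S u0 u1 u2) (S v0 v1 v2) (S w0 w1 w2)"
    unfolding T_def u'(1) v'(1) w'(1) det3_def add[OF R(1)] add[OF R(2)] add[OF R(3)] by Groebner_Basis.algebra
  moreover have "T u' v w \<in> P (3 * i + 3)"
    using P[OF u'(2) u(2,3)] by (simp add: algebra_simps)
  moreover have "T (S u0 u1 u2) v' w \<in> P (3 * i + 3)"
    using P[OF SP v'(2) u(3), of u0 u1 u2] by (simp add: algebra_simps)
  moreover have "T (S u0 u1 u2) (S v0 v1 v2) w' \<in> P (3 * i + 3)"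
    using P[OF SP SP w'(2), of u0 u1 u2 v0 v1 v2] by (simp add: algebra_simps)
  moreover have "T (S u0 u1 u2) (S v0 v1 v2) (S w0 w1 w2) \<in> P (3 * i + 3)"
  proof -
    have fS: "f (S a b c) = of_int a * f (\<kappa> ^ i) + of_int b * f (\<kappa> ^ (i + 1)) + of_int c * f (\<kappa> ^ (i + 2))"
      if "gal_like f j" for f j a b c
      unfolding S_def using gal_likeD[OF that] by (simp del: power_Suc add_Suc_right)
    have "T (S u0 u1 u2) (S v0 v1 v2) (S w0 w1 w2) =
      det3 (of_int u0) (of_int u1) (of_int u2) (of_int v0) (of_int v1) (of_int v2) (of_int w0) (of_int w1) (of_int w2)
      * T (\<kappa> ^ i) (\<kappa> ^ (i + 1)) (\<kappa> ^ (i + 2))"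
      unfolding T_def fS[OF f(1)] fS[OF f(2)] fS[OF f(3)] by (rule det3_mult)
    also have "\<dots> \<in> P (i + (i + 1) + (i + 2))"
      by (intro P_mult_R P P_kappa) (auto simp: det3_def)
    finally show ?thesis by (simp add: algebra_simps eval_nat_numeral)
  qed
  ultimately show ?thesis unfolding T_def[symmetric] by auto
qed

section \<open>Ideals\<close>

lemma P_is_ideal: "is_ideal R (P n)"
  using P_R by (auto simp: is_ideal_def)

lemma kappa_power_notin: "\<kappa> ^ n \<notin> P (Suc n)"
  using lead_P_iff[OF lead_kappa[of n]] prime_p(2) by auto

lemma ideal_generated_is_ideal:
  assumes "S \<subseteq> R"
  shows "is_ideal R (ideal_generated R S)" "S \<subseteq> ideal_generated R S"
proof -
  have "is_ideal R R" using P_is_ideal[of 0] by simp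
  hence R: "ideal_generated R S \<subseteq> R" using assms unfolding ideal_generated_def by blast
  show "S \<subseteq> ideal_generated R S" unfolding ideal_generated_def by blast
  show "is_ideal R (ideal_generated R S)"
    unfolding is_ideal_def
  proof (intro conjI ballI R)
    show "0 \<in> ideal_generated R S" by (auto simp: ideal_generated_def is_ideal_def)
    show "x + y \<in> ideal_generated R S" if "x \<in> ideal_generated R S" "y \<in> ideal_generated R S" for x y
      using that by (auto simp: ideal_generated_def is_ideal_def)
    show "r * x \<in> ideal_generated R S" if "r \<in> R" "x \<in> ideal_generated R S" for r x
      using that by (auto simp: ideal_generated_def is_ideal_def)
  qed
qed

text \<open>An element of least order generates the ideal, its unit cofactor being invertible. The
  bound \<open>m\<close> comes from the inclusion, the bound \<open>n\<close> from the given
  element.\<close>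

lemma ideal_eq_P:
  assumes I: "is_ideal R I" "I \<subseteq> P m" and x: "x \<in> I" "x \<notin> P (Suc n)"
  shows "\<exists>l. m \<le> l \<and> l \<le> n \<and> I = P l"
proof -
  define l where "l = (LEAST n. \<exists>x\<in>I. x \<notin> P (Suc n))"
  have ex: "\<exists>x\<in>I. x \<notin> P (Suc n)" using x by blast
  have "\<exists>x\<in>I. x \<notin> P (Suc l)" unfolding l_def using ex by (rule LeastI)
  then obtain z where z: "z \<in> I" "z \<notin> P (Suc l)" by blast
  have ln: "l \<le> n" unfolding l_def using ex by (rule Least_le)
  have IP: "I \<subseteq> P l"
  proof (cases l)
    case 0
    thus ?thesis using I by (auto simp: is_ideal_def)
  next
    case (Suc k)
    thus ?thesis using not_less_Least[of k "\<lambda>n. \<exists>x\<in>I. x \<notin> P (Suc n)"] by (auto simp: l_def)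
  qed
  have "m \<le> l"
  proof (rule ccontr)
    assume "\<not> m \<le> l"
    thus False using z I(2) P_mono[of "Suc l" m] by auto
  qed
  obtain u where u: "u \<in> R" "z = \<kappa> ^ l * u" using z(1) IP by (auto simp: P_def)
  have "u \<notin> P 1" using z(2) u(2) P_cancel[of l u 1] by auto
  then obtain v where v: "v \<in> R" "u * v = 1" using unit_iff[OF u(1)] by blast
  have "P l \<subseteq> I"
  proof
    fix y assume "y \<in> P l"
    then obtain r where r: "r \<in> R" "y = \<kappa> ^ l * r" by (auto simp: P_def)
    have "r * v * z = y * (u * v)" by (simp add: r(2) u(2) mult_ac)
    hence "y = r * v * z" using v by simp
    moreover have "r * v \<in> R" using r v by simp
    ultimately show "y \<in> I" using I(1) z(1) unfolding is_ideal_def by blast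
  qed
  thus ?thesis using IP ln \<open>m \<le> l\<close> by blast
qed

text \<open>Uniqueness for the definite description \<open>lam\<close>. The infinite exponent is
  excluded because \<open>P n\<close> contains the nonzero \<open>\<kappa> ^ n\<close>.\<close>

lemma ppow_inject:
  assumes "ppow \<theta> l = P n"
  shows "l = enat n"
proof (cases l)
  case (enat k)
  have "k = n"
  proof (rule ccontr)
    assume "k \<noteq> n"
    then consider "Suc k \<le> n" | "Suc n \<le> k" by linarith
    thus False
      by cases (use assms kappa_power_notin[of k] kappa_power_notin[of n] P_kappa[of k] P_kappa[of n]
          P_mono[of "Suc k" n] P_mono[of "Suc n" k] in \<open>auto simp: enat ppow_eq\<close>)
  qed
  thus ?thesis by (simp add: enat)
next
  case infinity
  hence "P n = {0}" using assms by (simp add: ppow_def)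
  hence "\<kappa> ^ n = 0" using P_kappa[of n] by (simp only: singleton_iff)
  thus ?thesis by simp
qed

end

section \<open>The maps \<open>c \<vartheta>\<^sub>a\<close>\<close>

locale scaled_theta_map = cyclotomic \<theta>
  for \<theta> :: "'p :: prime_card padic_closure" +
  fixes c :: "'p padic_closure" and a :: int and i :: nat
  assumes c_unit: "c \<in> R" "c \<notin> P 1"
    and a_bounds: "2 \<le> a" "2 * a \<le> int CARD('p) - 1"
begin

definition form :: "'p padic_closure \<Rightarrow> 'p padic_closure \<Rightarrow> 'p padic_closure" where
  "form x y = gal \<theta> a x * gal \<theta> (1 - a) y - gal \<theta> (1 - a) x * gal \<theta> a y"

abbreviation \<gamma> :: "'p tensors set \<Rightarrow> 'p padic_closure" where
  "\<gamma> \<equiv> scaled_vartheta \<theta> i c a"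

text \<open>Up to sign all four numbers lie strictly between 0 and \<open>p\<close>. The third is
  the difference of the multipliers \<open>a\<close> and \<open>1 - a\<close>, so the two
  automorphisms act differently on leading coefficients.\<close>

lemma not_dvd: "\<not> int CARD('p) dvd a" "\<not> int CARD('p) dvd 1 - a" "\<not> int CARD('p) dvd 2 * a - 1"
  "\<not> int CARD('p) dvd 2"
  using a_bounds zdvd_imp_le[of "int CARD('p)" a] zdvd_imp_le[of "int CARD('p)" "a - 1"]
    zdvd_imp_le[of "int CARD('p)" "2 * a - 1"] zdvd_imp_le[of "int CARD('p)" 2]
  by (auto simp: dvd_diff_commute[of _ 1 a])

lemmas gal_a = gal_gal_like[OF not_dvd(1)] and gal_b = gal_gal_like[OF not_dvd(2)]

text \<open>The free factor \<open>k\<close> lets one statement serve both \<open>vartheta\<close>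
  (\<open>k = 1\<close>) and \<open>\<gamma>\<close> (\<open>k = c\<close>).\<close>

lemma form_alternating: "alternating_bilinear (cyc_field \<theta>) (\<lambda>x y. k * form x y)"
  unfolding alternating_bilinear_def form_def
  by (auto simp: gal_add not_dvd gal_mult gal_of_padic algebra_simps)

lemma form_alternating_P: "alternating_bilinear (P n) (\<lambda>x y. k * form x y)"
  using form_alternating[of k] P_R R_cyc unfolding alternating_bilinear_def by blast

text \<open>In degree \<open>2 * n\<close> both products have leading coefficient
  \<open>a ^ n * (1 - a) ^ n * d * e\<close>, so they cancel. This is the source of the extra 1 in
  \<open>2 * i + 1\<close>.\<close>

lemma form_in_P:
  assumes "x \<in> P n" "y \<in> P n"
  shows "form x y \<in> P (2 * n + 1)"
proof -
  obtain d e where d: "lead n x d" and e: "lead n y e" using assms ex_lead by metis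
  have "lead (n + n) (form x y) ((a ^ n * d) * ((1 - a) ^ n * e) - ((1 - a) ^ n * d) * (a ^ n * e))"
    unfolding form_def
    by (intro lead_diff lead_mult lead_gal_like[OF gal_a] lead_gal_like[OF gal_b] d e)
  also have "(a ^ n * d) * ((1 - a) ^ n * e) - ((1 - a) ^ n * d) * (a ^ n * e) = 0" by simp
  finally show ?thesis by (simp add: lead_def mult_2)
qed

lemma vartheta_eq: "vartheta \<theta> a = restrict (induced_map form) (ext_square (cyc_field \<theta>))"
  (is "_ = ?t")
proof -
  let ?K = "cyc_field \<theta>"
  note alt = form_alternating[of 1, unfolded mult_1]
  have hom: "restrict (induced_map form) (ext_square (cyc_field \<theta>)) \<in> ext_hom (cyc_field \<theta>) (cyc_field \<theta>)"
    by (rule induced_map_ext_hom[OF alt]) (auto simp: form_def not_dvd)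
  have val: "restrict (induced_map form) (ext_square (cyc_field \<theta>)) (wedge (cyc_field \<theta>) x y) = form x y"
    if "x \<in> cyc_field \<theta>" "y \<in> cyc_field \<theta>" for x y
    using that by (simp add: wedge_in_ext_square induced_map_wedge[OF alt])
  show ?thesis
    unfolding vartheta_def form_def[symmetric]
  proof (rule the_equality)
    show "?t \<in> ext_hom ?K ?K \<and> (\<forall>x\<in>?K. \<forall>y\<in>?K. ?t (wedge ?K x y) = form x y)"
      by (intro conjI ballI hom val)
    fix t assume t: "t \<in> ext_hom ?K ?K \<and> (\<forall>x\<in>?K. \<forall>y\<in>?K. t (wedge ?K x y) = form x y)"
    show "t = ?t"
      by (rule ext_hom_unique[OF _ hom]) (use t in \<open>simp_all only: val\<close>)
  qed
qed

lemma P_cyc: "P n \<subseteq> cyc_field \<theta>"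
  using P_R by blast

lemma gamma_class:
  assumes "Poly_Mapping.keys f \<subseteq> P i \<times> P i"
  shows "\<gamma> (ext_class (P i) f) = extend_linear (\<lambda>x y. c * form x y) f"
proof -
  have "Poly_Mapping.keys f \<subseteq> cyc_field \<theta> \<times> cyc_field \<theta>" using assms P_cyc by blast
  thus ?thesis
    using assms form_alternating[of 1]
    by (simp add: scaled_vartheta_def ppow_eq ext_squareI vartheta_eq ext_class_inclusion[OF P_cyc]
        induced_map_class extend_linear_mult)
qed

lemma gamma_wedge: "x \<in> P i \<Longrightarrow> y \<in> P i \<Longrightarrow> \<gamma> (wedge (P i) x y) = c * form x y"
  unfolding wedge_def by (subst gamma_class) auto

lemma gamma_eq: "\<gamma> = restrict (induced_map (\<lambda>x y. c * form x y)) (ext_square (P i))"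
proof
  fix A
  show "\<gamma> A = restrict (induced_map (\<lambda>x y. c * form x y)) (ext_square (P i)) A"
  proof (cases "A \<in> ext_square (P i)")
    case True
    then obtain f where "A = ext_class (P i) f" "Poly_Mapping.keys f \<subseteq> P i \<times> P i" by (rule ext_squareE)
    thus ?thesis using True by (simp add: gamma_class induced_map_class[OF form_alternating_P])
  next
    case False
    thus ?thesis by (simp add: scaled_vartheta_def ppow_eq)
  qed
qed

section \<open>Equivariance and surjectivity\<close>

lemma gamma_in_P: "x \<in> P i \<Longrightarrow> y \<in> P i \<Longrightarrow> c * form x y \<in> P (2 * i + 1)"
  by (intro P_mult_R c_unit form_in_P)

text \<open>The exponents satisfy \<open>a + (1 - a) = 1\<close>, so the two conjugates of
  \<open>\<theta>\<close> multiply to \<open>\<theta>\<close>.\<close>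

lemma form_theta:
  assumes "x \<in> R" "y \<in> R"
  shows "form (\<theta> * x) (\<theta> * y) = \<theta> * form x y"
proof -
  have "gal \<theta> a \<theta> * gal \<theta> (1 - a) \<theta> = \<theta>"
    using theta_nonzero by (simp add: gal_theta not_dvd flip: power_int_add)
  hence "\<theta> * form x y = (gal \<theta> a \<theta> * gal \<theta> (1 - a) \<theta>) * form x y" by simp
  thus ?thesis unfolding form_def using assms
    by (simp add: gal_mult not_dvd algebra_simps)
qed

lemma gamma_in_H: "\<gamma> \<in> H \<theta> i"
proof -
  have "\<gamma> \<in> ext_hom (P i) (P (2 * i + 1))"
    unfolding gamma_eq
    by (rule induced_map_ext_hom[OF form_alternating_P gamma_in_P]) auto
  thus ?thesis
    using P_R by (auto simp: H_def ppow_eq gamma_wedge form_theta P_mult_R simp del: mult_Suc_right)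
qed

lemma prime_p_int: "prime (int CARD('p))"
  using prime_p by simp

text \<open>In degree 0 the multiplier is \<open>j ^ 0 = 1\<close>, so \<open>c\<close> and both its
  conjugates share one leading coefficient.\<close>

lemma c_lead:
  obtains d where "lead 0 c d" "\<not> int CARD('p) dvd d" "lead 0 (gal \<theta> a c) d" "lead 0 (gal \<theta> (1 - a) c) d"
proof -
  obtain d where d: "lead 0 c d" using ex_lead[of c 0] c_unit by auto
  have "\<not> int CARD('p) dvd d" using lead_P_iff[OF d] c_unit by simp
  thus ?thesis using that[of d] d lead_gal_like[OF gal_a d] lead_gal_like[OF gal_b d] by simp
qed

text \<open>The image is a module over the p-adic integers, and equivariance makes it closed under
  \<open>\<kappa> = \<theta> - 1\<close>: multiplying a value by \<open>\<theta>\<close> moves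
  \<open>(x, y)\<close> to \<open>(\<theta> * x, \<theta> * y)\<close>, hence the induction over
  arbitrary \<open>x\<close> and \<open>y\<close>. One value of order exactly
  \<open>2 * i + 1\<close> then suffices.\<close>

lemma gamma_surj: "P (2 * i + 1) \<subseteq> \<gamma> ` ext_square (P i)"
proof -
  let ?S = "\<gamma> ` ext_square (P i)"
  have mem: "extend_linear (\<lambda>x y. c * form x y) f \<in> ?S" if "Poly_Mapping.keys f \<subseteq> P i \<times> P i" for f
    using that by (metis gamma_class ext_squareI imageI)
  have rep: "\<exists>f. Poly_Mapping.keys f \<subseteq> P i \<times> P i \<and> s = extend_linear (\<lambda>x y. c * form x y) f" if "s \<in> ?S" for s
    using that gamma_class by (auto elim!: ext_squareE)
  have S_add: "s + t \<in> ?S" if st: "s \<in> ?S" "t \<in> ?S" for s t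
  proof -
    obtain f g where "Poly_Mapping.keys f \<subseteq> P i \<times> P i" "s = extend_linear (\<lambda>x y. c * form x y) f"
      "Poly_Mapping.keys g \<subseteq> P i \<times> P i" "t = extend_linear (\<lambda>x y. c * form x y) g"
      using rep st by metis
    thus ?thesis using mem[of "f + g"] keys_add[of f g] by (fastforce simp: extend_linear_add)
  qed
  have S_scale: "of_padic_int r * s \<in> ?S" if st: "s \<in> ?S" for r s
  proof -
    obtain f where "Poly_Mapping.keys f \<subseteq> P i \<times> P i" "s = extend_linear (\<lambda>x y. c * form x y) f"
      using rep st by metis
    thus ?thesis using mem[of "scale r f"] keys_scale[of r f] by (fastforce simp: extend_linear_scale)
  qed
  have base: "c * form x y \<in> ?S" if "x \<in> P i" "y \<in> P i" for x y
    using that gamma_wedge wedge_in_ext_square by (metis imageI)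
  have mult: "s * (c * form x y) \<in> ?S" if "s \<in> R" "x \<in> P i" "y \<in> P i" for s x y
    using that
  proof (induction arbitrary: x y rule: R_induct)
    case (step r s)
    have 0: "0 \<in> ?S" using S_scale[OF base[OF step(3,4)], of 0] by simp
    have s: "s * (c * form x y) \<in> ?S" if "x \<in> P i" "y \<in> P i" for x y
      using step(2) 0 that by auto
    have xy: "\<theta> * x \<in> P i" "\<theta> * y \<in> P i" using step(3,4) by auto
    have "(of_padic_int r + \<kappa> * s) * (c * form x y) = of_padic_int r * (c * form x y) +
        (s * (c * form (\<theta> * x) (\<theta> * y)) + of_padic_int (- 1) * (s * (c * form x y)))"
      using step(3,4) by (simp add: form_theta P_R kappa_def of_padic.hom_uminus algebra_simps)
    also have "\<dots> \<in> ?S"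
      by (intro S_add S_scale base s step(3,4) xy)
    finally show ?case .
  qed
  \<comment> \<open>Distinct exponents avoid the cancellation of \<open>form_in_P\<close>: the
    coefficient becomes a unit times \<open>1 - 2 * a\<close>.\<close>
  define g where "g = c * form (\<kappa> ^ i) (\<kappa> ^ (i + 1))"
  obtain d where d: "lead 0 c d" "\<not> int CARD('p) dvd d" by (rule c_lead)
  define b where "b = 1 - a"
  have "lead (0 + (i + (i + 1))) g (d * (a ^ i * b ^ (i + 1) - b ^ i * a ^ (i + 1)))"
    unfolding g_def form_def b_def
    by (intro lead_mult lead_diff d lead_gal_like_kappa gal_a gal_b)
  moreover have "d * (a ^ i * b ^ (i + 1) - b ^ i * a ^ (i + 1)) = d * (a ^ i * b ^ i * - (2 * a - 1))"
    by (simp add: b_def algebra_simps)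
  moreover have "\<not> int CARD('p) dvd d * (a ^ i * b ^ i * - (2 * a - 1))"
    using d(2) not_dvd prime_p_int prime_dvd_power[OF prime_p_int]
    by (auto simp: prime_dvd_mult_iff b_def dvd_minus_iff simp del: minus_diff_eq)
  ultimately have "g \<notin> P (Suc (2 * i + 1))"
    using lead_P_iff by (metis add_0 add.assoc mult_2)
  moreover have gP: "g \<in> P (2 * i + 1)"
    unfolding g_def using P_mono[of i "i + 1"] P_kappa[of "i + 1"] by (intro gamma_in_P) auto
  then obtain u where u: "u \<in> R" "g = \<kappa> ^ (2 * i + 1) * u" by (auto simp: P_def)
  ultimately have "u \<notin> P 1" using P_cancel[of "2 * i + 1" u 1] by (metis Suc_eq_plus1)
  then obtain v where v: "v \<in> R" "u * v = 1" using unit_iff[OF u(1)] by blast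
  show ?thesis
  proof
    fix z assume "z \<in> P (2 * i + 1)"
    then obtain r where r: "r \<in> R" "z = \<kappa> ^ (2 * i + 1) * r" by (auto simp: P_def)
    have "r * v * g = z * (u * v)" by (simp only: r(2) u(2) mult_ac)
    hence "z = r * v * g" using v by simp
    moreover have "\<kappa> ^ (i + 1) \<in> P i" using P_mono[of i "i + 1"] P_kappa[of "i + 1"] by auto
    hence "r * v * g \<in> ?S" unfolding g_def using r v by (intro mult) auto
    ultimately show "z \<in> ?S" by simp
  qed
qed

lemma gamma_in_H_hat: "\<gamma> \<in> H_hat \<theta> i"
proof -
  have "\<gamma> ` ext_square (P i) \<subseteq> P (2 * i + 1)"
    using gamma_in_H by (auto simp: H_def ext_hom_def ppow_eq)
  thus ?thesis using gamma_in_H gamma_surj by (simp add: H_hat_def ppow_eq)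
qed

section \<open>The Jacobi expression as a sum of two determinants\<close>

definition jac_det :: "'p padic_closure \<Rightarrow> 'p padic_closure \<Rightarrow> 'p padic_closure \<Rightarrow> 'p padic_closure" where
  "jac_det u v w = (let f = gal \<theta> a; g = gal \<theta> (1 - a) in
     c * (f c * det3 (f (f u)) (f (g u)) (g u) (f (f v)) (f (g v)) (g v) (f (f w)) (f (g w)) (g w) +
          g c * det3 (g (g u)) (f (g u)) (f u) (g (g v)) (f (g v)) (f v) (g (g w)) (f (g w)) (f w)))"

lemma form_form:
  assumes "u \<in> R" "v \<in> R"
  shows "c * form (c * form u v) w = (let f = gal \<theta> a; g = gal \<theta> (1 - a) in
    c * (f c * (f (f u) * f (g v) - f (g u) * f (f v)) * g w - g c * (f (g u) * g (g v) - g (g u) * f (g v)) * f w))"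
proof -
  note ga = gal_likeD(1,2,3)[OF gal_a] gal_like_diff[OF gal_a]
  note gb = gal_likeD(1,2,3)[OF gal_b] gal_like_diff[OF gal_b]
  show ?thesis
    using assms c_unit gal_commute[OF not_dvd(2,1)]
    by (simp add: Let_def form_def ga gb)
qed

text \<open>The inner bracket contributes \<open>2 \<times> 2\<close> minors, and the cyclic sum is
  a cofactor expansion along the column of the outer automorphism. Commuting automorphisms give both
  determinants the same middle column.\<close>

lemma jacobi_eq:
  assumes "u \<in> P i" "v \<in> P i" "w \<in> P i"
  shows "jacobi \<theta> i \<gamma> u v w = jac_det u v w"
proof -
  have P: "c * form x y \<in> P i" if "x \<in> P i" "y \<in> P i" for x y
    using gamma_in_P[OF that] P_mono[of i "2 * i + 1"] by auto
  note R = P_R[OF assms(1)] P_R[OF assms(2)] P_R[OF assms(3)]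
  have "jacobi \<theta> i \<gamma> u v w = c * form (c * form u v) w + c * form (c * form v w) u + c * form (c * form w u) v"
    using assms P by (simp add: jacobi_def Let_def ppow_eq gamma_wedge)
  also have "\<dots> = jac_det u v w"
    unfolding form_form[OF R(1,2)] form_form[OF R(2,3)] form_form[OF R(3,1)] jac_det_def Let_def det3_def
    by Groebner_Basis.algebra
  finally show ?thesis .
qed

lemmas gal_aa = gal_like_compose[OF gal_a gal_a] and gal_ab = gal_like_compose[OF gal_a gal_b]
  and gal_bb = gal_like_compose[OF gal_b gal_b]

lemma jacobi_in_P:
  assumes "u \<in> P i" "v \<in> P i" "w \<in> P i"
  shows "jacobi \<theta> i \<gamma> u v w \<in> P (3 * i + 3)"
  unfolding jacobi_eq[OF assms] jac_det_def Let_def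
  by (intro P_mult_R P_add det3_gal_like_in_P[OF gal_aa gal_ab gal_b] det3_gal_like_in_P[OF gal_bb gal_ab gal_a]
      assms c_unit gal_likeD(1)[OF gal_a] gal_likeD(1)[OF gal_b])

text \<open>Both conjugates of \<open>c\<close> have the same leading coefficient \<open>d\<close>,
  so the two determinants enter with equal weight and the total is \<open>d * d\<close> times
  \<open>jacobi_lead\<close>.\<close>

lemma jacobi_notin_P:
  assumes "\<not> int CARD('p) dvd jacobi_lead a l m n" "i \<le> l" "i \<le> m" "i \<le> n"
  shows "jacobi \<theta> i \<gamma> (\<kappa> ^ l) (\<kappa> ^ m) (\<kappa> ^ n) \<notin> P (Suc (l + m + n))"
proof -
  obtain d where d: "lead 0 c d" "\<not> int CARD('p) dvd d" "lead 0 (gal \<theta> a c) d" "lead 0 (gal \<theta> (1 - a) c) d"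
    by (rule c_lead)
  have P: "\<kappa> ^ l \<in> P i" "\<kappa> ^ m \<in> P i" "\<kappa> ^ n \<in> P i"
    using assms(2-4) P_mono P_kappa by blast+
  note k = lead_gal_like_kappa[OF gal_aa] lead_gal_like_kappa[OF gal_ab] lead_gal_like_kappa[OF gal_bb]
    lead_gal_like_kappa[OF gal_a] lead_gal_like_kappa[OF gal_b]
  have "lead (0 + (0 + (l + m + n))) (jacobi \<theta> i \<gamma> (\<kappa> ^ l) (\<kappa> ^ m) (\<kappa> ^ n)) (d * (d *
     det3 ((a * a) ^ l) ((a * (1 - a)) ^ l) ((1 - a) ^ l) ((a * a) ^ m) ((a * (1 - a)) ^ m) ((1 - a) ^ m)
       ((a * a) ^ n) ((a * (1 - a)) ^ n) ((1 - a) ^ n) + d *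
     det3 (((1 - a) * (1 - a)) ^ l) ((a * (1 - a)) ^ l) (a ^ l) (((1 - a) * (1 - a)) ^ m) ((a * (1 - a)) ^ m) (a ^ m)
       (((1 - a) * (1 - a)) ^ n) ((a * (1 - a)) ^ n) (a ^ n)))"
    unfolding jacobi_eq[OF P] jac_det_def Let_def
    by (intro lead_mult lead_add lead_det3 d k)
  hence "lead (l + m + n) (jacobi \<theta> i \<gamma> (\<kappa> ^ l) (\<kappa> ^ m) (\<kappa> ^ n)) (d * (d * jacobi_lead a l m n))"
    by (simp add: jacobi_lead_def Let_def distrib_left)
  thus ?thesis using lead_P_iff d(2) assms(1) prime_p_int by (simp add: prime_dvd_mult_iff)
qed

lemma jacobi_ideal_eq:
  "\<exists>y\<in>{0, 1, 2}. jacobi_ideal \<theta> i \<gamma> = P (3 * i + 3 + y) \<and> (CARD('p) = 5 \<longrightarrow> y = 0)"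
proof -
  define S where "S = {jacobi \<theta> i \<gamma> u v w | u v w. u \<in> P i \<and> v \<in> P i \<and> w \<in> P i}"
  have J: "jacobi_ideal \<theta> i \<gamma> = ideal_generated R S"
    by (simp add: jacobi_ideal_def S_def integers_eq ppow_eq)
  have SP: "S \<subseteq> P (3 * i + 3)" using jacobi_in_P by (auto simp: S_def)
  have SR: "S \<subseteq> R" using SP P_R by blast
  note I = ideal_generated_is_ideal[OF SR]
  have IP: "ideal_generated R S \<subseteq> P (3 * i + 3)"
    using SP P_is_ideal unfolding ideal_generated_def by blast
  have mem: "jacobi \<theta> i \<gamma> (\<kappa> ^ l) (\<kappa> ^ m) (\<kappa> ^ n) \<in> ideal_generated R S" if "i \<le> l" "i \<le> m" "i \<le> n" for l m n
  proof -
    have "\<kappa> ^ l \<in> P i" "\<kappa> ^ m \<in> P i" "\<kappa> ^ n \<in> P i" using that P_mono P_kappa by blast+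
    hence "jacobi \<theta> i \<gamma> (\<kappa> ^ l) (\<kappa> ^ m) (\<kappa> ^ n) \<in> S" unfolding S_def by blast
    thus ?thesis using I(2) by blast
  qed
  show ?thesis
  proof (cases "int CARD('p) dvd jacobi_lead a i (i + 1) (i + 2)")
    case False
    have eq: "i + (i + 1) + (i + 2) = 3 * i + 3" by simp
    have "jacobi \<theta> i \<gamma> (\<kappa> ^ i) (\<kappa> ^ (i + 1)) (\<kappa> ^ (i + 2)) \<notin> P (Suc (3 * i + 3))"
      using jacobi_notin_P[OF False, unfolded eq] by simp
    from ideal_eq_P[OF I(1) IP mem this] obtain l where "3 * i + 3 \<le> l" "l \<le> 3 * i + 3" "ideal_generated R S = P l"
      by auto
    hence "jacobi_ideal \<theta> i \<gamma> = P (3 * i + 3 + 0)" unfolding J by simp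
    thus ?thesis by blast
  next
    case True
    have ne: "\<not> int CARD('p) dvd jacobi_lead a i (i + 2) (i + 3)"
      using jacobi_lead_nonzero[OF prime_p_int not_dvd(4,1,2,3) True] by blast
    \<comment> \<open>An element outside \<open>P (3 * i + 6)\<close> caps the exponent of the ideal
      at \<open>3 * i + 5\<close>.\<close>
    have eq: "i + (i + 2) + (i + 3) = 3 * i + 5" by simp
    have "jacobi \<theta> i \<gamma> (\<kappa> ^ i) (\<kappa> ^ (i + 2)) (\<kappa> ^ (i + 3)) \<notin> P (Suc (3 * i + 5))"
      using jacobi_notin_P[OF ne, unfolded eq] by simp
    from ideal_eq_P[OF I(1) IP mem this] obtain l where l: "3 * i + 3 \<le> l" "l \<le> 3 * i + 5" "ideal_generated R S = P l"
      by auto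
    define y where "y = l - (3 * i + 3)"
    have y: "y \<in> {0, 1, 2}" "l = 3 * i + 3 + y" using l by (auto simp: y_def)
    have "CARD('p) \<noteq> 5"
    proof
      assume 5: "CARD('p) = 5"
      \<comment> \<open>For \<open>p = 5\<close> the bounds read \<open>2 \<le> a\<close> and
        \<open>2 * a \<le> 4\<close>.\<close>
      hence "a = 2" using a_bounds by simp
      thus False using True jacobi_lead_five[of i] 5 by simp
    qed
    moreover have "jacobi_ideal \<theta> i \<gamma> = P (3 * i + 3 + y)" unfolding J l(3) y(2) ..
    ultimately show ?thesis using y(1) by blast
  qed
qed

lemma lam_eq:
  assumes "jacobi_ideal \<theta> i \<gamma> = P n"
  shows "lam \<theta> i \<gamma> = enat n"
  unfolding lam_def assms by (rule the_equality) (use ppow_inject in \<open>auto simp: ppow_eq\<close>)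

lemma card_L:
  "\<exists>y\<in>{0, 1, 2}. card (carrier (L \<theta> i (lam \<theta> i \<gamma>) \<gamma>)) = CARD('p) ^ (2 * i + 3 + y) \<and>
     (CARD('p) = 5 \<longrightarrow> y = 0)"
proof -
  obtain y where y: "y \<in> {0, 1, 2}" "jacobi_ideal \<theta> i \<gamma> = P (3 * i + 3 + y)" "CARD('p) = 5 \<longrightarrow> y = 0"
    using jacobi_ideal_eq by blast
  \<comment> \<open>The classes counted are those of \<open>P i\<close>, so \<open>i\<close> is
    split off from the exponent of the ideal.\<close>
  have "3 * i + 3 + y = i + (2 * i + 3 + y)" by simp
  hence "carrier (L \<theta> i (lam \<theta> i \<gamma>) \<gamma>) = pcoset \<theta> (enat (i + (2 * i + 3 + y))) ` P i"
    using lam_eq[OF y(2)] by (simp add: L_def ppow_eq add.assoc)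
  hence "card (carrier (L \<theta> i (lam \<theta> i \<gamma>) \<gamma>)) = CARD('p) ^ (2 * i + 3 + y)"
    by (simp only: card_pcosets)
  thus ?thesis using y by blast
qed

end

theorem theorem4:
  fixes \<theta> c :: "'p :: prime_card padic_closure"
    and i :: nat
    and a :: int
    and \<gamma> :: "'p tensors set \<Rightarrow> 'p padic_closure"
  assumes "CARD('p) \<ge> 5"
    and "primitive_root_of_unity CARD('p) \<theta>"
    and "c \<in> unit_group \<theta>"
    and "2 \<le> a" and "a \<le> (int CARD('p) - 1) div 2"
    and "\<gamma> = scaled_vartheta \<theta> i c a"
  shows "\<gamma> \<in> H_hat \<theta> i \<and>
    (\<exists>y \<in> {0, 1, 2}.
       card (carrier (L \<theta> i (lam \<theta> i \<gamma>) \<gamma>)) = CARD('p) ^ (2 * i + 3 + y) \<and>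
       (CARD('p) = 5 \<longrightarrow> y = 0))"
proof -
  interpret cyclotomic \<theta> by standard (rule assms(2))
  have "c \<in> R" "c \<notin> P 1"
    using assms(3) ppow_eq[of 1] by (auto simp: unit_group_def integers_eq one_enat_def)
  moreover have "2 * a \<le> int CARD('p) - 1" using assms(5) by linarith
  ultimately interpret scaled_theta_map \<theta> c a i using assms(4) by unfold_locales
  show ?thesis unfolding assms(6) using gamma_in_H_hat card_L by blast
qed

end
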